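(* Let $\sigma\ge0$, let $f\in L^1_{\mathrm{loc}}(\mathbb{R})$ be $1$-periodic with $f(t)-\sigma>0$ for a.e. $t$, and suppose that the firing map $\Phi$ of $\dot{x}=-\sigma x+f(t)$ has irrational rotation number $\varrho$. Let $\varphi$ be the firing phase map, $\Gamma$ a lift of the map $\gamma$ (semi-)conjugating $\varphi$ with the rotation by $\varrho$, $\Psi(t)=\Phi(t)-t$, $\Lambda$ the Lebesgue measure on $[0,1]$, and $\mu_{\mathrm{ISI}}$ the distribution of interspike-intervals. Then $\mu_{\mathrm{ISI}}$ is a transported Lebesgue measure: 1. If $\varphi$ is transitive, then $\mu_{\mathrm{ISI}}(A)=\Lambda(\Omega^{-1}(A))$ for every Borel set $A\subset\mathbb{R}$, where $\Omega(t)=\Gamma^{-1}(t+\varrho)-\Gamma^{-1}(t)$, $t\in[0,1]$; and $\operatorname{supp}(\mu_{\mathrm{ISI}})=\Psi([0,1])=\Omega([0,1])$. 2. If $\varphi$ is not transitive, then $\mu_{\mathrm{ISI}}(A)=\Lambda(\widehat{\Omega}^{-1}(A))$ for every Borel set $A\subset\widehat{\mathcal S}:=\Psi(\widetilde{\Delta})$, where $\widehat{\Omega}(t)=\widehat{\Gamma}^{-1}(t+\varrho)-\widehat{\Gamma}^{-1}(t)$, $t\in[0,1]$; and $\operatorname{supp}(\mu_{\mathrm{ISI}})=\Psi(\widetilde{\Delta})$.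
   Context: $1$-periodic means $f(t+1)=f(t)$ for a.e. $t$. The firing map of $\dot{x}=-\sigma x+f(t)$ is $\Phi(t):=\inf\{t_*>t:\ e^{\sigma t}\le\int_t^{t_*}[f(u)-\sigma]e^{\sigma u}\,du\}$. Under the assumptions $\Phi$ is a lift of an orientation preserving circle homeomorphism $\varphi:S^1\to S^1$ (under $t\mapsto e^{2\pi it}$), the firing phase map, and $\varrho=\lim_n\Phi^n(t)/n$. Since $\varrho$ is irrational, there is a continuous monotone degree-one map $\gamma:S^1\to S^1$ with $\gamma\circ\varphi=r_\varrho\circ\gamma$, where $r_\varrho$ is the rotation by $\varrho$; its lift $\Gamma:\mathbb{R}\to\mathbb{R}$ is continuous, non-decreasing, with $\Gamma(t+1)=\Gamma(t)+1$ and $\Gamma(\Phi(t))=\Gamma(t)+\varrho$. If $\varphi$ is transitive (has a dense orbit), $\gamma$ and $\Gamma$ are homeomorphisms. If $\varphi$ is not transitive, its unique minimal set $\Delta\subset S^1$ is a Cantor set, $\widetilde{\Delta}=\{t\in\mathbb{R}:e^{2\pi it}\in\Delta\}$, $\widehat{\Delta}\subset\Delta$ denotes a subset on which $\gamma$ is invertible (i.e. $\gamma|_{\widehat\Delta}$ is a bijection onto $S^1$), and $\widehat{\Gamma}$ is the restriction of $\Gamma$ to the lift $\{t\in\mathbb{R}: e^{2\pi i t}\in\widehat{\Delta}\}$ of $\widehat\Delta$, a bijection onto $\mathbb{R}$. The distribution of interspike-intervals is $\mu_{\mathrm{ISI}}(A):=\mu(\{t\in[0,1]:\Phi(t)-t\in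 A\})$, where $\mu$ is the unique invariant Borel probability measure of $\varphi$, regarded as an invariant measure of $\Phi \bmod 1$ on $[0,1]$ (with $0$ and $1$ identified). *)

theory Defs
  imports "HOL-Probability.Probability"
begin

section \<open>The firing map\<close>

definition locally_integrable :: "(real \<Rightarrow> real) \<Rightarrow> bool" where
  "locally_integrable f \<longleftrightarrow> (\<forall>K. compact K \<longrightarrow> set_integrable lebesgue K f)"

text \<open>The condition below says that the solution of \<open>x' = -\<sigma> x + f\<close> started at \<open>x(t) = 0\<close> has
  reached the threshold \<open>1\<close> at time \<open>s\<close> (multiply \<open>x(s) \<ge> 1\<close> by \<open>exp (\<sigma> s)\<close> and use
  \<open>exp (\<sigma> s) = exp (\<sigma> t) + \<integral>\<^sub>t\<^sup>s \<sigma> exp (\<sigma> u) du\<close>).\<close>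

definition firing_map :: "real \<Rightarrow> (real \<Rightarrow> real) \<Rightarrow> real \<Rightarrow> real" where
  "firing_map \<sigma> f t =
     Inf {s. s > t \<and> exp (\<sigma> * t) \<le> (LINT u:{t..s}|lebesgue. (f u - \<sigma>) * exp (\<sigma> * u))}"

definition firing_displacement :: "real \<Rightarrow> (real \<Rightarrow> real) \<Rightarrow> real \<Rightarrow> real" where
  "firing_displacement \<sigma> f t = firing_map \<sigma> f t - t"

definition has_rotation_number :: "(real \<Rightarrow> real) \<Rightarrow> real \<Rightarrow> bool" where
  "has_rotation_number F r \<longleftrightarrow> (\<forall>t. (\<lambda>n. (F ^^ n) t / real n) \<longlonglongrightarrow> r)"


section \<open>Circle maps\<close>

text \<open>The circle is \<open>sphere 0 1\<close> in the complex plane; circle maps are functions on \<open>complex\<close> of which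
  only the values on \<open>sphere 0 1\<close> matter. Points of the circle have the phase coordinate
  \<open>circle_phase z \<in> {0..<1}\<close>, so that the endpoints of \<open>{0..1}\<close> are identified.\<close>

definition circle_proj :: "real \<Rightarrow> complex" where
  "circle_proj t = cis (2 * pi * t)"

definition circle_phase :: "complex \<Rightarrow> real" where
  "circle_phase z = Arg2pi z / (2 * pi)"

lemma circle_proj_phase: "z \<in> sphere 0 1 \<Longrightarrow> circle_proj (circle_phase z) = z"
  using Arg2pi_eq[of z] by (simp add: circle_proj_def circle_phase_def cis_conv_exp)

definition lift_of :: "(real \<Rightarrow> real) \<Rightarrow> (complex \<Rightarrow> complex) \<Rightarrow> bool" where
  "lift_of G g \<longleftrightarrow>
     continuous_on UNIV G \<and> (\<forall>t. g (circle_proj t) = circle_proj (G t))"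

text \<open>The circle map with lift \<open>firing_map \<sigma> f\<close>. The choice of the representative
  \<open>circle_phase z\<close> is immaterial when \<open>firing_map \<sigma> f (t + 1) = firing_map \<sigma> f t + 1\<close>.\<close>

definition firing_phase_map :: "real \<Rightarrow> (real \<Rightarrow> real) \<Rightarrow> complex \<Rightarrow> complex" where
  "firing_phase_map \<sigma> f z = circle_proj (firing_map \<sigma> f (circle_phase z))"

definition monotone_degree_one :: "(complex \<Rightarrow> complex) \<Rightarrow> bool" where
  "monotone_degree_one g \<longleftrightarrow> (\<exists>G. lift_of G g \<and> mono G \<and> (\<forall>t. G (t + 1) = G t + 1))"

definition semiconj_to_rotation ::
    "(complex \<Rightarrow> complex) \<Rightarrow> real \<Rightarrow> (complex \<Rightarrow> complex) \<Rightarrow> bool" where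
  "semiconj_to_rotation \<phi> r g \<longleftrightarrow>
     continuous_on (sphere 0 1) g \<and> g ` sphere 0 1 \<subseteq> sphere 0 1 \<and> monotone_degree_one g \<and>
     (\<forall>z\<in>sphere 0 1. g (\<phi> z) = circle_proj r * g z)"

definition circle_transitive :: "(complex \<Rightarrow> complex) \<Rightarrow> bool" where
  "circle_transitive \<phi> \<longleftrightarrow>
     (\<exists>z\<in>sphere 0 1. closure (range (\<lambda>n. (\<phi> ^^ n) z)) = sphere 0 1)"

definition circle_invariant_closed :: "(complex \<Rightarrow> complex) \<Rightarrow> complex set \<Rightarrow> bool" where
  "circle_invariant_closed \<phi> D \<longleftrightarrow> D \<noteq> {} \<and> D \<subseteq> sphere 0 1 \<and> closed D \<and> \<phi> ` D \<subseteq> D"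

definition minimal_set :: "(complex \<Rightarrow> complex) \<Rightarrow> complex set \<Rightarrow> bool" where
  "minimal_set \<phi> D \<longleftrightarrow> circle_invariant_closed \<phi> D \<and>
     (\<forall>E. circle_invariant_closed \<phi> E \<and> E \<subseteq> D \<longrightarrow> E = D)"

definition circle_lift_set :: "complex set \<Rightarrow> real set" where
  "circle_lift_set D = {t. circle_proj t \<in> D}"


section \<open>The distribution of interspike-intervals\<close>

definition invariant_prob :: "(complex \<Rightarrow> complex) \<Rightarrow> complex measure \<Rightarrow> bool" where
  "invariant_prob \<phi> \<mu> \<longleftrightarrow>
     sets \<mu> = sets (restrict_space borel (sphere 0 1)) \<and> prob_space \<mu> \<and>
     \<phi> \<in> measurable \<mu> \<mu> \<and> distr \<mu> \<mu> \<phi> = \<mu>"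

definition on_unit_interval :: "complex measure \<Rightarrow> real measure" where
  "on_unit_interval \<mu> = distr \<mu> (restrict_space borel {0..1}) circle_phase"

definition isi_distribution ::
    "real \<Rightarrow> (real \<Rightarrow> real) \<Rightarrow> complex measure \<Rightarrow> real measure" where
  "isi_distribution \<sigma> f \<mu> = distr (on_unit_interval \<mu>) borel (firing_displacement \<sigma> f)"

definition measure_support :: "real measure \<Rightarrow> real set" where
  "measure_support M = {x. \<forall>U. open U \<and> x \<in> U \<longrightarrow> emeasure M U > 0}"

end

theory Submission
  imports Defs
begin

text \<open>
  The distribution function of the invariant measure lifts to a monotone degree-one map \<open>M\<close> of the
  line with \<open>M (\<Phi> t) = M t + c\<close>. The rotation number forces \<open>c = \<rho>\<close>, and since the numbers
  \<open>n \<rho> + k\<close> are dense, \<open>M\<close> agrees with \<open>\<Gamma>\<close> up to a constant. Consequently every right inverse \<open>\<Theta>\<close>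
  of \<open>\<Gamma>\<close> that commutes with the translation by \<open>1\<close> transports Lebesgue measure to the invariant
  measure. Both \<open>\<Phi> (\<Theta> t)\<close> and \<open>\<Theta> (t + \<rho>)\<close> are preimages of \<open>t + \<rho>\<close> under \<open>\<Gamma>\<close>, so they coincide
  unless \<open>t + \<rho>\<close> is one of the countably many discontinuities of \<open>\<Theta>\<close>. This gives the formula for
  the distribution in both cases at once, with \<open>\<Theta> = \<Gamma>\<^sup>-\<^sup>1\<close> or \<open>\<Theta>\<close> the inverse of the restriction of \<open>\<Gamma>\<close>.
  The support comes from the set of points at which \<open>\<Gamma>\<close> is not locally constant, which is the lift of
  every minimal set.
\<close>

section \<open>The firing map\<close>

text \<open>Comparing \<open>\<Phi> x\<close> with \<open>a\<close> amounts to comparing the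
  continuous \<open>H x\<close> with \<open>G a\<close>, so order neighbourhoods of
  \<open>\<Phi> t\<close> pull back to neighbourhoods of \<open>t\<close>.\<close>

lemma strict_mono_inverse_image_continuous:
  fixes G H \<Phi> :: "real \<Rightarrow> real"
  assumes "continuous_on UNIV H" "strict_mono G" "\<And>t. G (\<Phi> t) = H t"
  shows "continuous_on UNIV \<Phi>"
proof -
  have "isCont \<Phi> t" for t
    unfolding isCont_def
  proof (rule order_tendstoI)
    have H: "(H \<longlongrightarrow> H t) (at t)"
      using assms(1) by (simp add: continuous_on_eq_continuous_at isCont_def)
    fix a
    show "\<forall>\<^sub>F x in at t. a < \<Phi> x" if "a < \<Phi> t"
      using order_tendstoD(1)[OF H, of "G a"] that
      unfolding assms(3)[symmetric] strict_mono_less[OF assms(2)] by blast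
    show "\<forall>\<^sub>F x in at t. \<Phi> x < a" if "\<Phi> t < a"
      using order_tendstoD(2)[OF H, of "G a"] that
      unfolding assms(3)[symmetric] strict_mono_less[OF assms(2)] by blast
  qed
  then show ?thesis by (simp add: continuous_at_imp_continuous_on)
qed

locale integrate_and_fire =
  fixes \<sigma> :: real and f :: "real \<Rightarrow> real"
  assumes sigma_nonneg: "\<sigma> \<ge> 0"
    and f_integrable: "locally_integrable f"
    and f_periodic: "AE t in lebesgue. f (t + 1) = f t"
    and f_above: "AE t in lebesgue. f t - \<sigma> > 0"
begin

definition rate :: "real \<Rightarrow> real" where "rate u = (f u - \<sigma>) * exp (\<sigma> * u)"

definition charge :: "real \<Rightarrow> real \<Rightarrow> real" where
  "charge a b = (LINT u:{a..b}|lebesgue. rate u)"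

lemma rate_integrable: "set_integrable lebesgue {a..b} rate"
proof -
  have "set_integrable lebesgue {a..b} (\<lambda>u. f u - \<sigma>)"
    using f_integrable
    by (intro set_integral_diff(1)) (auto simp: locally_integrable_def
        intro!: absolutely_integrable_continuous_real[of _ _ "\<lambda>_. \<sigma>"])
  moreover have "(\<lambda>u. exp (\<sigma> * u)) \<in> borel_measurable (lebesgue_on {a..b})"
    by (intro continuous_imp_measurable_on_sets_lebesgue continuous_intros) auto
  moreover have "bounded ((\<lambda>u. exp (\<sigma> * u)) ` {a..b})"
    by (intro compact_imp_bounded compact_continuous_image continuous_intros) auto
  ultimately have "set_integrable lebesgue {a..b} (\<lambda>u. exp (\<sigma> * u) * (f u - \<sigma>))"
    by (intro absolutely_integrable_bounded_measurable_product_real) auto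
  then show ?thesis
    by (simp add: rate_def [abs_def] mult.commute)
qed

lemma rate_integrable_on: "rate integrable_on {a..b}"
  using rate_integrable set_lebesgue_integral_eq_integral(1) by blast

lemma charge_eq_integral: "charge a b = integral {a..b} rate"
  unfolding charge_def using rate_integrable set_lebesgue_integral_eq_integral(2) by blast

lemma charge_refl [simp]: "charge a a = 0"
  by (simp add: charge_eq_integral)

lemma charge_add:
  assumes "a \<le> b" "b \<le> c"
  shows "charge a b + charge b c = charge a c"
  unfolding charge_eq_integral
  using assms Henstock_Kurzweil_Integration.integral_combine rate_integrable_on by blast

lemma charge_pos:
  assumes "a < b"
  shows "charge a b > 0"
proof -
  have int: "integrable lebesgue (\<lambda>u. indicator {a..b} u *\<^sub>R rate u)"
    using rate_integrable by (simp add: set_integrable_def)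
  have nonneg: "AE u in lebesgue. 0 \<le> indicator {a..b} u *\<^sub>R rate u"
    using f_above by eventually_elim (auto simp: rate_def indicator_def)
  have "charge a b \<noteq> 0"
  proof
    assume "charge a b = 0"
    then have "AE u in lebesgue. indicator {a..b} u *\<^sub>R rate u = 0"
      using integral_nonneg_eq_0_iff_AE[OF int nonneg]
      by (simp add: charge_def set_lebesgue_integral_def)
    with f_above have "AE u in lebesgue. u \<in> {a<..<b} \<longrightarrow> u \<in> {}"
      by eventually_elim (auto simp: rate_def indicator_def)
    \<comment> \<open>An open set that lies in a closed set up to a null set lies in it entirely;
      with the closed set \<open>{}\<close>, a null open interval has no point, not even its
      midpoint.\<close>
    then show False
      using mem_closed_if_AE_lebesgue_open[of "{a<..<b}" "{}" "(a + b) / 2"] assms by auto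
  qed
  moreover have "charge a b \<ge> 0"
    unfolding charge_def set_lebesgue_integral_def by (rule integral_nonneg_AE [OF nonneg])
  ultimately show ?thesis by linarith
qed

text \<open>A shift by one period leaves \<open>f\<close> unchanged off a null set and multiplies
  the weight \<open>exp (\<sigma> * u)\<close> by \<open>exp \<sigma>\<close>.\<close>

lemma charge_shift: "charge (a + 1) (b + 1) = exp \<sigma> * charge a b"
proof -
  have "charge (a + 1) (b + 1) = integral {a..b} (rate \<circ> (+) 1)"
    by (simp add: charge_eq_integral integral_shift_Icc_real)
  also have "\<dots> = integral {a..b} (\<lambda>u. exp \<sigma> * rate u)"
  proof -
    obtain N where N: "N \<in> null_sets lebesgue" "{t \<in> space lebesgue. f (t + 1) \<noteq> f t} \<subseteq> N"
      using f_periodic unfolding eventually_ae_filter by blast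
    show ?thesis
    proof (rule integral_spike [of N])
      show "negligible N" using N(1) by (simp add: negligible_iff_null_sets)
      show "exp \<sigma> * rate u = (rate \<circ> (+) 1) u" if "u \<in> {a..b} - N" for u
      proof -
        have "f (u + 1) = f u" using that N(2) by auto
        then show ?thesis by (simp add: rate_def add.commute distrib_left exp_add)
      qed
    qed
  qed
  finally show ?thesis by (simp add: charge_eq_integral)
qed

text \<open>The antiderivative of \<open>rate\<close> that vanishes at 0. The case split stands for
  an oriented integral, since the interval from 0 to a negative \<open>t\<close> is empty. With it
  the firing condition at \<open>s\<close> becomes
  \<open>potential t + exp (\<sigma> * t) \<le> potential s\<close>.\<close>

definition potential :: "real \<Rightarrow> real" where
  "potential t = (if t \<ge> 0 then charge 0 t else - charge t 0)"

lemma charge_eq_potential: "a \<le> b \<Longrightarrow> charge a b = potential b - potential a"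
  using charge_add[of a b 0] charge_add[of 0 a b] charge_add[of a 0 b] charge_refl[of 0]
  unfolding potential_def by (smt (verit))

lemma potential_strict_mono: "strict_mono potential"
  using charge_pos charge_eq_potential by (intro strict_monoI) (metis diff_gt_0_iff_gt less_imp_le)

lemma potential_continuous: "continuous_on UNIV potential"
proof -
  have "isCont potential t" for t
  proof -
    have "continuous_on {t - 1..t + 1} (\<lambda>x. potential (t - 1) + integral {t - 1..x} rate)"
      by (intro continuous_intros indefinite_integral_continuous_1 rate_integrable_on)
    then have "continuous_on {t - 1..t + 1} potential"
      using charge_eq_potential[of "t - 1"]
      by (elim continuous_on_eq) (auto simp: charge_eq_integral)
    then have "continuous_on {t - 1<..<t + 1} potential"
      by (rule continuous_on_subset) auto
    then show ?thesis
      by (simp add: continuous_on_eq_continuous_at)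
  qed
  then show ?thesis by (simp add: continuous_at_imp_continuous_on)
qed

text \<open>Since \<open>exp \<sigma> \<ge> 1\<close>, every later period contributes at least the
  charge \<open>c\<close> of the first one, so the potential outgrows every linear bound with slope
  below \<open>c\<close>.\<close>

lemma potential_unbounded: "\<exists>s\<ge>t. y \<le> potential s"
proof -
  define c where "c = charge t (t + 1)"
  have c: "c > 0" by (simp add: c_def charge_pos)
  have step: "charge (t + real n) (t + real n + 1) \<ge> c" for n
  proof (induction n)
    case (Suc n)
    have "c \<le> charge (t + real n) (t + real n + 1)" by (rule Suc)
    also have "\<dots> \<le> exp \<sigma> * charge (t + real n) (t + real n + 1)"
      using sigma_nonneg c Suc mult_right_mono[of 1 "exp \<sigma>" "charge (t + real n) (t + real n + 1)"]
      by simp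
    also have "\<dots> = charge (t + real (Suc n)) (t + real (Suc n) + 1)"
      by (simp add: charge_shift [symmetric] add_ac)
    finally show ?case .
  qed (simp add: c_def)
  have lower: "potential (t + real n) \<ge> potential t + n * c" for n
  proof (induction n)
    case (Suc n)
    show ?case
      using Suc step[of n] charge_eq_potential[of "t + real n" "t + real n + 1"]
      by (simp add: algebra_simps)
  qed simp
  obtain n where "y - potential t \<le> real n * c"
    using c reals_Archimedean3 less_imp_le by meson
  then show ?thesis
    using lower[of n] by (intro exI[of _ "t + real n"]) auto
qed

text \<open>The intermediate value theorem gives a time \<open>s\<close> of exact equality, and
  strict monotonicity identifies the set of admissible times with \<open>{s..}\<close>; so the
  infimum is attained. From here on this implicit equation replaces the definition by an
  infimum.\<close>

lemma firing_map_greater_and_potential: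
  "t < firing_map \<sigma> f t \<and> potential (firing_map \<sigma> f t) = potential t + exp (\<sigma> * t)"
proof -
  obtain b where b: "b \<ge> t" "potential t + exp (\<sigma> * t) \<le> potential b"
    using potential_unbounded by blast
  obtain s where s: "t \<le> s" "potential s = potential t + exp (\<sigma> * t)"
    using IVT'[of potential t "potential t + exp (\<sigma> * t)" b] b
      continuous_on_subset[OF potential_continuous] by auto
  have "t \<noteq> s" using s(2) by auto
  then have "t < s" using s(1) by simp
  have "{s'. s' > t \<and> exp (\<sigma> * t) \<le> charge t s'} = {s..}"
  proof (intro set_eqI iffI CollectI)
    show "s' \<in> {s..}" if "s' \<in> {s'. s' > t \<and> exp (\<sigma> * t) \<le> charge t s'}" for s'
      using that s(2) strict_mono_less_eq[OF potential_strict_mono, of s s']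
        charge_eq_potential[of t s'] by simp
    show "s' > t \<and> exp (\<sigma> * t) \<le> charge t s'" if "s' \<in> {s..}" for s'
      using that s(2) \<open>t < s\<close> strict_mono_less_eq[OF potential_strict_mono, of s s']
        charge_eq_potential[of t s'] by simp
  qed
  then have "firing_map \<sigma> f t = s"
    by (simp add: firing_map_def charge_def rate_def)
  then show ?thesis using s \<open>t < s\<close> by simp
qed

lemmas firing_map_greater = firing_map_greater_and_potential [THEN conjunct1]
lemmas potential_firing_map = firing_map_greater_and_potential [THEN conjunct2]

lemma firing_map_continuous: "continuous_on UNIV (firing_map \<sigma> f)"
  by (rule strict_mono_inverse_image_continuous[OF _ potential_strict_mono potential_firing_map])
    (intro continuous_intros potential_continuous)

lemma firing_map_strict_mono: "strict_mono (firing_map \<sigma> f)"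
proof (rule strict_monoI)
  fix s t :: real assume "s < t"
  then have "potential s < potential t" "\<sigma> * s \<le> \<sigma> * t"
    using strict_mono_less[OF potential_strict_mono] sigma_nonneg by (auto intro: mult_left_mono)
  then have "potential (firing_map \<sigma> f s) < potential (firing_map \<sigma> f t)"
    by (simp add: potential_firing_map add_less_le_mono)
  then show "firing_map \<sigma> f s < firing_map \<sigma> f t"
    by (simp add: strict_mono_less[OF potential_strict_mono])
qed

text \<open>The charge over an interval and the threshold \<open>exp (\<sigma> * t)\<close> both
  gain the factor \<open>exp \<sigma>\<close> under the shift, so the two sides have the same
  potential.\<close>

lemma firing_map_add_1: "firing_map \<sigma> f (t + 1) = firing_map \<sigma> f t + 1"
proof -
  let ?s = "firing_map \<sigma> f t"
  have "potential (?s + 1) - potential (t + 1) = charge (t + 1) (?s + 1)"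
    using firing_map_greater[of t] by (simp add: charge_eq_potential)
  also have "\<dots> = exp \<sigma> * exp (\<sigma> * t)"
    using firing_map_greater[of t]
    by (simp add: charge_shift charge_eq_potential potential_firing_map)
  also have "\<dots> = potential (firing_map \<sigma> f (t + 1)) - potential (t + 1)"
    by (simp add: potential_firing_map distrib_left add.commute flip: exp_add)
  finally show ?thesis
    by (simp add: strict_mono_eq[OF potential_strict_mono])
qed

end

section \<open>Degree-one maps of the line\<close>

lemma degree_one_add_int:
  fixes h :: "real \<Rightarrow> real"
  assumes "\<And>t. h (t + 1) = h t + 1"
  shows "h (t + of_int k) = h t + of_int k"
proof (induction k rule: int_induct[where k = 0])
  case (step1 i)
  then show ?case using assms[of "t + of_int i"] by (simp add: add_ac)
next
  case (step2 i)
  then show ?case using assms[of "t + of_int i - 1"] by (simp add: algebra_simps)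
qed simp

lemma periodic_add_int:
  fixes p :: "real \<Rightarrow> 'a"
  assumes "\<And>t. p (t + 1) = p t"
  shows "p (t + of_int k) = p t"
proof (induction k rule: int_induct[where k = 0])
  case (step1 i)
  then show ?case using assms[of "t + of_int i"] by (simp add: add_ac)
next
  case (step2 i)
  then show ?case using assms[of "t + of_int i - 1"] by (simp add: algebra_simps)
qed simp

lemma periodic_frac:
  fixes p :: "real \<Rightarrow> 'a"
  assumes "\<And>t. p (t + 1) = p t"
  shows "p (frac t) = p t"
  using periodic_add_int[of p "frac t" "\<lfloor>t\<rfloor>", OF assms] by (simp add: frac_def)

text \<open>Makes the image of a closed periodic set the image of a compact one.\<close>

lemma periodic_image:
  fixes p :: "real \<Rightarrow> 'a"
  assumes "\<And>t. p (t + 1) = p t" and "\<And>t. t + 1 \<in> B \<longleftrightarrow> t \<in> B"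
  shows "p ` B = p ` (B \<inter> {0..1})"
proof -
  have "p t \<in> p ` (B \<inter> {0..1})" if "t \<in> B" for t
  proof -
    have "frac t \<in> B"
      using that periodic_frac[of "\<lambda>t. t \<in> B" t] assms(2) by simp
    then show ?thesis
      using periodic_frac[of p t, OF assms(1)] frac_lt_1[of t] by (intro image_eqI[of _ _ "frac t"]) auto
  qed
  then show ?thesis by auto
qed

text \<open>At integers \<open>h\<close> is exactly a translation, and monotonicity controls it in
  between.\<close>

lemma degree_one_deviation:
  fixes h :: "real \<Rightarrow> real"
  assumes "mono h" "\<And>t. h (t + 1) = h t + 1"
  shows "\<bar>h x - h 0 - x\<bar> \<le> 1"
proof -
  have "h (of_int k) = h 0 + of_int k" for k
    using degree_one_add_int[of h 0 k, OF assms(2)] by simp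
  then have "h (of_int \<lfloor>x\<rfloor>) = h 0 + of_int \<lfloor>x\<rfloor>"
      "h (of_int (\<lfloor>x\<rfloor> + 1)) = h 0 + of_int (\<lfloor>x\<rfloor> + 1)" by blast+
  moreover have "h (of_int \<lfloor>x\<rfloor>) \<le> h x" "h x \<le> h (of_int (\<lfloor>x\<rfloor> + 1))"
    by (intro monoD[OF assms(1)]; linarith)+
  ultimately show ?thesis by linarith
qed

lemma funpow_translate:
  fixes h :: "'a \<Rightarrow> real"
  assumes "\<And>t. h (F t) = h t + c"
  shows "h ((F ^^ n) t) = h t + real n * c"
  by (induction n) (simp_all add: assms algebra_simps)

text \<open>Along an orbit \<open>h\<close> grows by exactly \<open>c\<close> per step, while
  \<open>h\<close> stays within 1 of a translation; hence \<open>(F ^^ n) 0\<close> is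
  \<open>n * c\<close> up to an error of at most 1.\<close>

lemma rotation_number_semiconj:
  assumes "has_rotation_number F r" "mono h" "\<And>t. h (t + 1) = h t + 1"
    and "\<And>t. h (F t) = h t + c"
  shows "c = r"
proof -
  have "\<bar>(F ^^ n) 0 / real n - c\<bar> \<le> 1 / real n" if "n > 0" for n
  proof -
    have "(F ^^ n) 0 / real n - c = ((F ^^ n) 0 - real n * c) / real n"
      using that by (simp add: diff_divide_distrib)
    moreover have "\<bar>(F ^^ n) 0 - real n * c\<bar> \<le> 1"
      using degree_one_deviation[of h "(F ^^ n) 0"] assms(2,3) funpow_translate[of h F c n 0, OF assms(4)]
      by (simp add: abs_minus_commute)
    ultimately show ?thesis
      using that by (simp add: divide_right_mono)
  qed
  then have "(\<lambda>n. (F ^^ n) 0 / real n - c) \<longlonglongrightarrow> 0"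
    by (intro Lim_null_comparison[OF _ lim_1_over_n])
      (auto intro!: eventually_mono[OF eventually_gt_at_top[of 0]])
  then have "(\<lambda>n. (F ^^ n) 0 / real n) \<longlonglongrightarrow> c"
    by (simp add: LIM_zero_iff)
  moreover have "(\<lambda>n. (F ^^ n) 0 / real n) \<longlonglongrightarrow> r"
    using assms(1) by (simp add: has_rotation_number_def)
  ultimately show ?thesis using LIMSEQ_unique by blast
qed

text \<open>The density of fractional parts is applied at the midpoint of the interval, with half
  its length as tolerance. Only nonnegative multiples of \<open>r\<close> occur, so forward orbits
  will suffice.\<close>

lemma irrational_multiples_dense:
  fixes r :: real
  assumes "r \<notin> \<rat>" "a < b"
  shows "\<exists>(n::nat) (k::int). a < x + real n * r + of_int k \<and> x + real n * r + of_int k < b"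
proof -
  obtain h k :: int where hk: "k > 0"
    "\<bar>of_int k * r - of_int h - ((a + b) / 2 - x)\<bar> < (b - a) / 2"
    using sequence_of_fractional_parts_is_dense[OF assms(1), of "(b - a) / 2" "(a + b) / 2 - x"] assms(2)
    by (metis diff_gt_0_iff_gt half_gt_zero)
  then have "\<bar>real (nat k) * r - of_int h - ((a + b) / 2 - x)\<bar> < (b - a) / 2"
    by simp
  moreover have "a < x + z + - y \<and> x + z + - y < b" if "\<bar>z - y - ((a + b) / 2 - x)\<bar> < (b - a) / 2"
    for y z using that by (auto simp: abs_less_iff field_simps)
  ultimately have "a < x + real (nat k) * r + of_int (- h) \<and> x + real (nat k) * r + of_int (- h) < b"
    unfolding of_int_minus by blast
  then show ?thesis by blast
qed

text \<open>After an integer translation the window starts at some \<open>b\<close> in [0,1). The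
  piece beyond 1 is then moved back by 1 and fills the missing \<open>{0..<b}\<close>.\<close>

lemma emeasure_lborel_periodic:
  fixes B :: "real set"
  assumes [measurable]: "B \<in> sets borel" and per: "\<And>t. t + 1 \<in> B \<longleftrightarrow> t \<in> B"
  shows "emeasure lborel (B \<inter> {a..<a + 1}) = emeasure lborel (B \<inter> {0..<1})"
proof -
  have per': "of_int k + t \<in> B \<longleftrightarrow> t \<in> B" for t k
    using periodic_add_int[of "\<lambda>t. t \<in> B" t k] per by (simp add: add.commute)
  have shift: "emeasure lborel (B \<inter> {s + of_int k..<t + of_int k}) = emeasure lborel (B \<inter> {s..<t})"
    for s t k
  proof -
    have "emeasure lborel (B \<inter> {s + of_int k..<t + of_int k}) =
        emeasure (distr lborel borel ((+) (of_int k))) (B \<inter> {s + of_int k..<t + of_int k})"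
      by (simp add: lborel_distr_plus)
    also have "\<dots> = emeasure lborel (B \<inter> {s..<t})"
      by (subst emeasure_distr) (auto intro!: arg_cong2[where f = emeasure] simp: per')
    finally show ?thesis .
  qed
  define b where "b = frac a"
  have b: "0 \<le> b" "b < 1" by (simp_all add: b_def frac_lt_1)
  have "emeasure lborel (B \<inter> {a..<a + 1}) = emeasure lborel (B \<inter> {b..<b + 1})"
    using shift[of b "\<lfloor>a\<rfloor>" "b + 1"] by (simp add: b_def frac_def add_ac)
  also have "B \<inter> {b..<b + 1} = (B \<inter> {b..<1}) \<union> (B \<inter> {0 + of_int 1..<b + of_int 1})"
    using b by auto
  also have "emeasure lborel \<dots> = emeasure lborel (B \<inter> {b..<1}) + emeasure lborel (B \<inter> {0..<b})"
    by (subst plus_emeasure[symmetric]) (auto simp: shift[of 0 1 b, simplified])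
  also have "\<dots> = emeasure lborel ((B \<inter> {b..<1}) \<union> (B \<inter> {0..<b}))"
    by (intro plus_emeasure) auto
  also have "(B \<inter> {b..<1}) \<union> (B \<inter> {0..<b}) = B \<inter> {0..<1}"
    using b by auto
  finally show ?thesis .
qed

section \<open>Monotone semiconjugacies to an irrational rotation\<close>

locale circle_semiconjugacy =
  fixes \<Phi> \<Gamma> :: "real \<Rightarrow> real" and \<rho> :: real
  assumes Phi_continuous: "continuous_on UNIV \<Phi>"
    and Phi_strict_mono: "strict_mono \<Phi>"
    and Phi_add_1: "\<Phi> (t + 1) = \<Phi> t + 1"
    and Gamma_continuous: "continuous_on UNIV \<Gamma>"
    and Gamma_mono: "mono \<Gamma>"
    and Gamma_add_1: "\<Gamma> (t + 1) = \<Gamma> t + 1"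
    and Gamma_Phi: "\<Gamma> (\<Phi> t) = \<Gamma> t + \<rho>"
    and rotation_number: "has_rotation_number \<Phi> \<rho>"
    and irrational: "\<rho> \<notin> \<rat>"
begin

lemmas Gamma_add_int = degree_one_add_int[of \<Gamma>, OF Gamma_add_1]
lemmas Phi_add_int = degree_one_add_int[of \<Phi>, OF Phi_add_1]

lemma Gamma_le: "s \<le> t \<Longrightarrow> \<Gamma> s \<le> \<Gamma> t"
  using Gamma_mono by (rule monoD)

lemma Gamma_less_imp_less: "\<Gamma> s < \<Gamma> t \<Longrightarrow> s < t"
  using Gamma_le[of t s] by force

lemma Gamma_orbit: "\<Gamma> ((\<Phi> ^^ n) t + of_int k) = \<Gamma> t + real n * \<rho> + of_int k"
  by (simp add: Gamma_add_int funpow_translate[of \<Gamma> \<Phi> \<rho>, OF Gamma_Phi])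

lemma Gamma_orbit_dense:
  assumes "a < b"
  obtains n k where "a < \<Gamma> ((\<Phi> ^^ n) x + of_int k)" "\<Gamma> ((\<Phi> ^^ n) x + of_int k) < b"
  using irrational_multiples_dense[OF irrational assms, of "\<Gamma> x"] unfolding Gamma_orbit by blast

text \<open>First \<open>c = \<rho>\<close>, so \<open>M\<close> and \<open>\<Gamma>\<close> differ
  by a constant on the points \<open>(\<Phi> ^^ n) 0 + k\<close>. These points need not be dense in
  the line, but their \<open>\<Gamma>\<close>-values are, and a strict inequality between
  \<open>\<Gamma>\<close>-values orders the points; monotonicity then squeezes
  \<open>M t\<close>.\<close>

lemma semiconjugacy_unique:
  assumes "mono M" "\<And>t. M (t + 1) = M t + 1" "\<And>t. M (\<Phi> t) = M t + c"
  shows "M t = \<Gamma> t + (M 0 - \<Gamma> 0)"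
proof -
  have c: "c = \<rho>"
    using rotation_number_semiconj[OF rotation_number assms] .
  have orbit: "M ((\<Phi> ^^ n) 0 + of_int k) = \<Gamma> ((\<Phi> ^^ n) 0 + of_int k) + (M 0 - \<Gamma> 0)" for n k
    unfolding Gamma_orbit degree_one_add_int[of M, OF assms(2)]
    using funpow_translate[of M \<Phi> c n 0, OF assms(3)] c by simp
  show ?thesis
  proof (rule antisym)
    show "M t \<le> \<Gamma> t + (M 0 - \<Gamma> 0)"
    proof (rule field_le_epsilon)
      fix e :: real assume "e > 0"
      then obtain n k where nk: "\<Gamma> t < \<Gamma> ((\<Phi> ^^ n) 0 + of_int k)"
          "\<Gamma> ((\<Phi> ^^ n) 0 + of_int k) < \<Gamma> t + e"
        using Gamma_orbit_dense[of "\<Gamma> t" "\<Gamma> t + e" 0] by auto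
      have "M t \<le> M ((\<Phi> ^^ n) 0 + of_int k)"
        using Gamma_less_imp_less[OF nk(1)] assms(1) by (simp add: monoD)
      then show "M t \<le> \<Gamma> t + (M 0 - \<Gamma> 0) + e"
        using nk(2) unfolding orbit by linarith
    qed
    show "\<Gamma> t + (M 0 - \<Gamma> 0) \<le> M t"
    proof (rule field_le_epsilon)
      fix e :: real assume "e > 0"
      then obtain n k where nk: "\<Gamma> t - e < \<Gamma> ((\<Phi> ^^ n) 0 + of_int k)"
          "\<Gamma> ((\<Phi> ^^ n) 0 + of_int k) < \<Gamma> t"
        using Gamma_orbit_dense[of "\<Gamma> t - e" "\<Gamma> t" 0] by auto
      have "M ((\<Phi> ^^ n) 0 + of_int k) \<le> M t"
        using Gamma_less_imp_less[OF nk(2)] assms(1) by (simp add: monoD)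
      then show "\<Gamma> t + (M 0 - \<Gamma> 0) \<le> M t + e"
        using nk(1) unfolding orbit by linarith
    qed
  qed
qed

text \<open>The support of the Stieltjes measure of \<Gamma>: the condition fails at
  \<open>t\<close> exactly when \<Gamma> is constant on an interval around \<open>t\<close>.\<close>

definition growth_set :: "real set" where
  "growth_set = {t. \<forall>a b. a < t \<longrightarrow> t < b \<longrightarrow> \<Gamma> a < \<Gamma> b}"

lemma growth_setD: "t \<in> growth_set \<Longrightarrow> a < t \<Longrightarrow> t < b \<Longrightarrow> \<Gamma> a < \<Gamma> b"
  by (simp add: growth_set_def)

lemma closed_growth_set: "closed growth_set"
proof -
  have "open (- growth_set)"
  proof (rule topological_space_class.openI)
    fix t assume "t \<in> - growth_set"
    then obtain a b where ab: "a < t" "t < b" "\<not> \<Gamma> a < \<Gamma> b"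
      by (auto simp: growth_set_def)
    show "\<exists>T. open T \<and> t \<in> T \<and> T \<subseteq> - growth_set"
      by (rule exI[where x = "{a<..<b}"]) (use ab in \<open>auto simp: growth_set_def\<close>)
  qed
  then show ?thesis by (simp add: closed_def)
qed

lemma growth_set_add_1: "t + 1 \<in> growth_set \<longleftrightarrow> t \<in> growth_set"
proof
  assume t: "t \<in> growth_set"
  show "t + 1 \<in> growth_set"
    unfolding growth_set_def
  proof (intro CollectI allI impI)
    fix a b assume "a < t + 1" "t + 1 < b"
    then have "\<Gamma> (a - 1) < \<Gamma> (b - 1)" using t by (intro growth_setD[of t]) auto
    then show "\<Gamma> a < \<Gamma> b" using Gamma_add_1[of "a - 1"] Gamma_add_1[of "b - 1"] by simp
  qed
next
  assume t: "t + 1 \<in> growth_set"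
  show "t \<in> growth_set"
    unfolding growth_set_def
  proof (intro CollectI allI impI)
    fix a b assume "a < t" "t < b"
    then have "\<Gamma> (a + 1) < \<Gamma> (b + 1)" using t by (intro growth_setD[of "t + 1"]) auto
    then show "\<Gamma> a < \<Gamma> b" by (simp add: Gamma_add_1)
  qed
qed

text \<open>By continuity \<Phi> maps a small interval around \<open>t\<close> into (a, b), and
  \<open>\<Gamma> \<circ> \<Phi>\<close> increases on it by as much as \<Gamma> does.\<close>

lemma growth_set_Phi:
  assumes "t \<in> growth_set"
  shows "\<Phi> t \<in> growth_set"
  unfolding growth_set_def
proof (intro CollectI allI impI)
  fix a b assume ab: "a < \<Phi> t" "\<Phi> t < b"
  have "(\<Phi> \<longlongrightarrow> \<Phi> t) (at t)"
    using Phi_continuous by (simp add: continuous_on_eq_continuous_at isCont_def)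
  then have "\<forall>\<^sub>F x in at t. a < \<Phi> x" "\<forall>\<^sub>F x in at t. \<Phi> x < b"
    using ab order_tendstoD by blast+
  then have "\<forall>\<^sub>F x in at t. a < \<Phi> x \<and> \<Phi> x < b" by eventually_elim auto
  then obtain d where d: "d > 0" "\<And>x. x \<noteq> t \<Longrightarrow> dist x t < d \<Longrightarrow> a < \<Phi> x \<and> \<Phi> x < b"
    unfolding eventually_at by auto
  have "a < \<Phi> (t - d / 2)" "\<Phi> (t + d / 2) < b"
    using d by (auto simp: dist_real_def)
  then have "\<Gamma> a \<le> \<Gamma> (t - d / 2) + \<rho>" "\<Gamma> (t + d / 2) + \<rho> \<le> \<Gamma> b"
    unfolding Gamma_Phi[symmetric] by (auto intro: Gamma_le)
  moreover have "\<Gamma> (t - d / 2) < \<Gamma> (t + d / 2)"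
    using assms d(1) by (intro growth_setD) auto
  ultimately show "\<Gamma> a < \<Gamma> b" by linarith
qed

text \<open>The supremum of the points with \<open>\<Gamma> s \<le> \<Gamma> 0\<close> is a growth
  point: \<Gamma> is at most \<open>\<Gamma> 0\<close> to its left and larger to its right. The
  bound 1 comes from \<open>\<Gamma> 1 = \<Gamma> 0 + 1\<close>.\<close>

lemma growth_set_nonempty: "growth_set \<noteq> {}"
proof -
  define S where "S = {s. \<Gamma> s \<le> \<Gamma> 0}"
  have bound: "s \<le> 1" if "s \<in> S" for s
    using that Gamma_le[of 1 s] Gamma_add_1[of 0] by (cases "s \<le> 1") (auto simp: S_def)
  have S: "S \<noteq> {}" "bdd_above S"
    using bound by (auto simp: S_def intro!: bdd_aboveI[of _ 1])
  have "Sup S \<in> growth_set"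
    unfolding growth_set_def
  proof (intro CollectI allI impI)
    fix a b assume "a < Sup S" "Sup S < b"
    then obtain s where "s \<in> S" "a < s" using S by (auto simp: less_cSup_iff)
    then have "\<Gamma> a \<le> \<Gamma> 0" using Gamma_le[of a s] by (auto simp: S_def)
    moreover have "b \<notin> S" using cSup_upper[of b S] S(2) \<open>Sup S < b\<close> by auto
    ultimately show "\<Gamma> a < \<Gamma> b" by (auto simp: S_def)
  qed
  then show ?thesis by blast
qed

text \<open>Any starting point \<open>x\<close> works: the \<Gamma>-values of its translated orbit
  are dense, and one lying strictly between \<open>\<Gamma> a\<close> and \<open>\<Gamma> b\<close>
  forces the orbit point between \<open>a\<close> and \<open>b\<close>.\<close>

lemma orbit_accumulates_on_growth_set:
  assumes "t \<in> growth_set" "a < t" "t < b"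
  obtains n k where "(\<Phi> ^^ n) x + of_int k \<in> {a<..<b}"
proof -
  obtain n k where "\<Gamma> a < \<Gamma> ((\<Phi> ^^ n) x + of_int k)" "\<Gamma> ((\<Phi> ^^ n) x + of_int k) < \<Gamma> b"
    using Gamma_orbit_dense[OF growth_setD[OF assms]] by metis
  then show ?thesis using that Gamma_less_imp_less by force
qed

text \<open>Preimages are chosen for values in [0,1) only, by the intermediate value theorem, and
  then continued by integer translation; this makes the choice commute with the shift by 1.\<close>

lemma section_exists: "\<exists>\<Theta>. (\<forall>t. \<Gamma> (\<Theta> t) = t) \<and> (\<forall>t. \<Theta> (t + 1) = \<Theta> t + 1)"
proof -
  have "\<exists>s. \<Gamma> s = frac t" for t
  proof -
    define k where "k = \<lceil>\<bar>frac t - \<Gamma> 0\<bar>\<rceil>"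
    have "\<Gamma> (of_int j) = \<Gamma> 0 + of_int j" for j using Gamma_add_int[of 0 j] by simp
    moreover have "of_int k \<ge> \<bar>frac t - \<Gamma> 0\<bar>" by (simp add: k_def)
    ultimately have "\<Gamma> (of_int (- k)) \<le> frac t" "frac t \<le> \<Gamma> (of_int k)" "- of_int k \<le> real_of_int k"
      by (auto simp del: of_int_minus)+
    then show ?thesis
      using IVT'[of \<Gamma> "of_int (- k)" "frac t" "of_int k"]
        continuous_on_subset[OF Gamma_continuous] by auto
  qed
  then obtain S where S: "\<And>t. \<Gamma> (S t) = frac t" by metis
  define \<Theta> where "\<Theta> t = (SOME s. \<Gamma> s = frac t) + of_int \<lfloor>t\<rfloor>" for t
  have "\<Gamma> (SOME s. \<Gamma> s = frac t) = frac t" for t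
    by (rule someI[of "\<lambda>s. \<Gamma> s = frac t"]) (rule S)
  then have "\<Gamma> (\<Theta> t) = t" for t
    by (simp add: \<Theta>_def Gamma_add_int frac_def)
  moreover have "\<Theta> (t + 1) = \<Theta> t + 1" for t
    by (simp add: \<Theta>_def frac_1_eq)
  ultimately show ?thesis by blast
qed

end

section \<open>Right inverses of the semiconjugacy\<close>

locale circle_semiconjugacy_section = circle_semiconjugacy +
  fixes \<Theta> :: "real \<Rightarrow> real"
  assumes Gamma_Theta: "\<Gamma> (\<Theta> t) = t"
    and Theta_add_1: "\<Theta> (t + 1) = \<Theta> t + 1"
begin

lemma Theta_less: "t < \<Gamma> x \<Longrightarrow> \<Theta> t < x"
  and less_Theta: "\<Gamma> x < t \<Longrightarrow> x < \<Theta> t"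
  using Gamma_less_imp_less Gamma_Theta by metis+

text \<open>Every right inverse of a monotone map is monotone; this makes \<Theta> Borel and leaves
  it only countably many discontinuities.\<close>

lemma Theta_mono: "mono \<Theta>"
  using Theta_less[of _ "\<Theta> _"] Gamma_Theta by (intro monoI) (metis less_eq_real_def)

lemma Theta_measurable [measurable]: "\<Theta> \<in> borel_measurable borel"
  using Theta_mono by (rule borel_measurable_mono)

lemma AE_isCont_Theta: "AE t in lborel. isCont \<Theta> (t + c)"
proof (rule AE_I')
  have "countable ((\<lambda>t. t - c) ` {t. \<not> isCont \<Theta> t})"
    using Theta_mono by (intro countable_image mono_ctble_discont)
  then show "(\<lambda>t. t - c) ` {t. \<not> isCont \<Theta> t} \<in> null_sets lborel"
    by (rule countable_imp_null_set_lborel)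
  show "{t \<in> space lborel. \<not> isCont \<Theta> (t + c)} \<subseteq> (\<lambda>t. t - c) ` {t. \<not> isCont \<Theta> t}"
    by (auto intro!: image_eqI[where x = "_ + c"])
qed

text \<open>A preimage \<open>x\<close> of \<open>t\<close> satisfies \<open>\<Theta> s < x\<close>
  for \<open>s < t\<close> and \<open>x < \<Theta> s\<close> for \<open>s > t\<close>; at a
  continuity point both one-sided limits are \<open>\<Theta> t\<close>.\<close>

lemma preimage_at_continuity_point:
  assumes "isCont \<Theta> t" "\<Gamma> x = t"
  shows "x = \<Theta> t"
proof (rule antisym)
  have "(\<Theta> \<longlongrightarrow> \<Theta> t) (at_right t)" "(\<Theta> \<longlongrightarrow> \<Theta> t) (at_left t)"
    using assms(1) by (auto simp: isCont_def filterlim_at_split)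
  moreover have "\<forall>\<^sub>F s in at_right t. x \<le> \<Theta> s" "\<forall>\<^sub>F s in at_left t. \<Theta> s \<le> x"
    using assms(2) less_Theta Theta_less
    by (auto simp: eventually_at_filter intro!: always_eventually less_imp_le)
  ultimately show "x \<le> \<Theta> t" "\<Theta> t \<le> x"
    using tendsto_lowerbound tendsto_upperbound by (metis trivial_limit_at_right_real, metis trivial_limit_at_left_real)
qed

text \<open>At a continuity point \<open>\<Theta> t\<close> is the only preimage of
  \<open>t\<close>, so \<Gamma> lies strictly below \<open>t\<close> on its left and strictly above
  on its right.\<close>

lemma Theta_in_growth_set:
  assumes "isCont \<Theta> t"
  shows "\<Theta> t \<in> growth_set"
  unfolding growth_set_def
proof (intro CollectI allI impI)
  fix a b assume ab: "a < \<Theta> t" "\<Theta> t < b"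
  then have "\<Gamma> a \<noteq> t" "\<Gamma> b \<noteq> t"
    using preimage_at_continuity_point[OF assms] by force+
  moreover have "\<Gamma> a \<le> t" "t \<le> \<Gamma> b"
    using Gamma_le[of a "\<Theta> t"] Gamma_le[of "\<Theta> t" b] ab by (auto simp: Gamma_Theta)
  ultimately show "\<Gamma> a < \<Gamma> b" by linarith
qed

lemma Phi_Theta:
  assumes "isCont \<Theta> (t + \<rho>)"
  shows "\<Phi> (\<Theta> t) = \<Theta> (t + \<rho>)"
  by (rule preimage_at_continuity_point[OF assms]) (simp add: Gamma_Phi Gamma_Theta)

end


section \<open>Invariant measures\<close>

lemma frac_measurable [measurable]: "(frac :: real \<Rightarrow> real) \<in> borel_measurable borel"
  unfolding frac_def [abs_def] by measurable

lemma frac_id: "0 \<le> x \<Longrightarrow> x < 1 \<Longrightarrow> frac x = (x :: real)"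
  by (simp add: frac_eq)

text \<open>The arc of the circle from \<open>s\<close> to \<open>t\<close> in the coordinate [0,1),
  that is, the fractional parts of the points of (s, t]. The quantified integer covers arcs that
  pass through 0.\<close>

definition lifted_interval :: "real \<Rightarrow> real \<Rightarrow> real set" where
  "lifted_interval s t = {x \<in> {0..<1}. \<exists>k::int. s < x + of_int k \<and> x + of_int k \<le> t}"

lemma lifted_interval_shift:
  "lifted_interval (s + of_int j) (t + of_int j) = lifted_interval s t"
proof -
  have "(\<exists>k::int. s + of_int j < x + of_int k \<and> x + of_int k \<le> t + of_int j) \<longleftrightarrow>
      (\<exists>k::int. s < x + of_int k \<and> x + of_int k \<le> t)" (is "?L \<longleftrightarrow> ?R") for x
  proof
    assume ?L
    then obtain k :: int where "s + of_int j < x + of_int k" "x + of_int k \<le> t + of_int j" by blast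
    then show ?R by (intro exI[of _ "k - j"]) simp
  next
    assume ?R
    then obtain k :: int where "s < x + of_int k" "x + of_int k \<le> t" by blast
    then show ?L by (intro exI[of _ "k + j"]) simp
  qed
  then show ?thesis by (simp add: lifted_interval_def)
qed

lemma lifted_interval_unit:
  assumes "0 \<le> s" "s < 1" "s \<le> t" "t \<le> s + 1"
  shows "lifted_interval s t = (if t < 1 then {s<..t} else {s<..<1} \<union> {0..t - 1})"
proof -
  have "(\<exists>k::int. s < x + of_int k \<and> x + of_int k \<le> t) \<longleftrightarrow> s < x \<and> x \<le> t \<or> x \<le> t - 1"
    (is "?L \<longleftrightarrow> ?R") if x: "0 \<le> x" "x < 1" for x
  proof
    assume ?L
    then obtain k :: int where k: "s < x + of_int k" "x + of_int k \<le> t" by blast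
    \<comment> \<open>An arc of length at most 1 that starts in [0,1) wraps around at most
      once.\<close>
    have "of_int k > (-1 :: real)" "of_int k < (2 :: real)" using k x assms by linarith+
    then have "k = 0 \<or> k = 1" by linarith
    then show ?R using k by auto
  next
    assume ?R
    then show ?L
    proof
      assume "s < x \<and> x \<le> t" then show ?L by (intro exI[of _ 0]) simp
    next
      assume "x \<le> t - 1" then show ?L using assms x by (intro exI[of _ 1]) simp
    qed
  qed
  then have "lifted_interval s t = {x \<in> {0..<1}. s < x \<and> x \<le> t \<or> x \<le> t - 1}"
    by (auto simp: lifted_interval_def)
  also have "\<dots> = (if t < 1 then {s<..t} else {s<..<1} \<union> {0..t - 1})"
    using assms by auto
  finally show ?thesis .
qed

lemma frac_in_lifted_interval:
  "frac y \<in> lifted_interval a b \<longleftrightarrow> (\<exists>k::int. a < y + of_int k \<and> y + of_int k \<le> b)"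
proof
  assume "frac y \<in> lifted_interval a b"
  then obtain k :: int where "a < frac y + of_int k" "frac y + of_int k \<le> b"
    by (auto simp: lifted_interval_def)
  then show "\<exists>k::int. a < y + of_int k \<and> y + of_int k \<le> b"
    by (intro exI[of _ "k - \<lfloor>y\<rfloor>"]) (simp add: frac_def)
next
  assume "\<exists>k::int. a < y + of_int k \<and> y + of_int k \<le> b"
  then obtain k :: int where "a < y + of_int k" "y + of_int k \<le> b" by blast
  then have "\<exists>k::int. a < frac y + of_int k \<and> frac y + of_int k \<le> b"
    by (intro exI[of _ "k + \<lfloor>y\<rfloor>"]) (simp add: frac_def)
  then show "frac y \<in> lifted_interval a b"
    by (simp add: lifted_interval_def frac_lt_1)
qed

section \<open>The distribution function of an invariant measure\<close>

locale invariant_circle_measure = circle_semiconjugacy + real_distribution \<nu> for \<nu> +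
  assumes concentrated: "AE x in \<nu>. x \<in> {0..<1}"
    and invariant: "distr \<nu> borel (\<lambda>x. frac (\<Phi> x)) = \<nu>"
begin

lemma Phi_measurable [measurable]: "\<Phi> \<in> borel_measurable borel"
  using Phi_continuous by (rule borel_measurable_continuous_onI)

text \<open>The map \<open>M\<close> of the overview: the distribution function on [0,1), continued
  with degree one. Its value at 0 is the mass of the point 0, which is shown to vanish only in
  \<open>distribution_lift_eq\<close>.\<close>

definition distribution_lift :: "real \<Rightarrow> real" where
  "distribution_lift t = of_int \<lfloor>t\<rfloor> + cdf \<nu> (frac t)"

lemma distribution_lift_add_1: "distribution_lift (t + 1) = distribution_lift t + 1"
  by (simp add: distribution_lift_def frac_1_eq)

lemmas distribution_lift_add_int = degree_one_add_int[of distribution_lift, OF distribution_lift_add_1]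

lemma distribution_lift_unit: "0 \<le> t \<Longrightarrow> t < 1 \<Longrightarrow> distribution_lift t = cdf \<nu> t"
  by (simp add: distribution_lift_def frac_id floor_eq_iff)

lemma measure_unit: "measure \<nu> {..<1} = 1" and measure_neg: "x < 0 \<Longrightarrow> measure \<nu> {..x} = 0"
proof -
  show "measure \<nu> {..<1} = 1"
    using concentrated by (intro prob_eq_1[THEN iffD2]) (auto elim: eventually_mono)
  have "prob {..x} = 0 \<longleftrightarrow> (AE y in \<nu>. y \<notin> {..x})" for x by (rule prob_eq_0) simp
  then show "x < 0 \<Longrightarrow> measure \<nu> {..x} = 0"
    using concentrated by (auto elim!: eventually_mono)
qed

lemma measure_Icc_0:
  assumes "0 \<le> x"
  shows "measure \<nu> {0..x} = cdf \<nu> x"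
proof -
  have "measure \<nu> {0..x} = measure \<nu> {..x}"
    using concentrated by (intro measure_eq_AE) (auto elim!: eventually_mono)
  then show ?thesis by (simp add: cdf_def)
qed

lemma measure_lifted_interval:
  assumes "s \<le> t" "t \<le> s + 1"
  shows "measure \<nu> (lifted_interval s t) = distribution_lift t - distribution_lift s"
proof -
  have *: "measure \<nu> (lifted_interval s t) = distribution_lift t - distribution_lift s"
    if st: "0 \<le> s" "s < 1" "s \<le> t" "t \<le> s + 1" for s t
  proof (cases "t < 1")
    case True
    then have "measure \<nu> {s<..t} = cdf \<nu> t - cdf \<nu> s"
      using st by (cases "s = t") (auto simp: cdf_diff_eq)
    then show ?thesis
      using st True by (simp add: lifted_interval_unit distribution_lift_unit)
  next
    case False
    have "{..<1} = {..s} \<union> {s<..<1::real}" using st by auto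
    moreover have "measure \<nu> ({..s} \<union> {s<..<1}) = measure \<nu> {..s} + measure \<nu> {s<..<1}"
      by (intro finite_measure_Union) auto
    ultimately have "1 = cdf \<nu> s + measure \<nu> {s<..<1}"
      using measure_unit by (simp add: cdf_def)
    moreover have "measure \<nu> ({s<..<1} \<union> {0..t - 1}) = measure \<nu> {s<..<1} + measure \<nu> {0..t - 1}"
      using st by (intro finite_measure_Union) auto
    moreover have "distribution_lift t = 1 + cdf \<nu> (t - 1)"
      using distribution_lift_add_1[of "t - 1"] distribution_lift_unit[of "t - 1"] st False by simp
    ultimately show ?thesis
      using st False by (simp add: lifted_interval_unit distribution_lift_unit measure_Icc_0)
  qed
  have "measure \<nu> (lifted_interval (frac s) (t - of_int \<lfloor>s\<rfloor>)) =
      distribution_lift (t - of_int \<lfloor>s\<rfloor>) - distribution_lift (frac s)"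
    using assms by (intro *) (auto simp: frac_lt_1 frac_def, linarith+)
  then show ?thesis
    using lifted_interval_shift[of "frac s" "\<lfloor>s\<rfloor>" "t - of_int \<lfloor>s\<rfloor>"]
      distribution_lift_add_int[of "frac s" "\<lfloor>s\<rfloor>"]
      distribution_lift_add_int[of "t - of_int \<lfloor>s\<rfloor>" "\<lfloor>s\<rfloor>"]
    by (simp add: frac_def)
qed

text \<open>Increments over length at most 1 are measures of arcs; longer ones are shortened by an
  integer, which only adds a nonnegative term.\<close>

lemma distribution_lift_mono: "mono distribution_lift"
proof (rule monoI)
  fix s t :: real assume "s \<le> t"
  have near: "distribution_lift s \<le> distribution_lift t" if "s \<le> t" "t \<le> s + 1" for s t
    using measure_lifted_interval[OF that] measure_nonneg[of \<nu> "lifted_interval s t"] by linarith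
  define k where "k = \<lfloor>t - s\<rfloor>"
  have "distribution_lift s \<le> distribution_lift (t - of_int k)"
    by (rule near) (simp_all add: k_def, linarith+)
  also have "\<dots> = distribution_lift t - of_int k"
    using distribution_lift_add_int[of "t - of_int k" k] by simp
  also have "\<dots> \<le> distribution_lift t"
    using \<open>s \<le> t\<close> by (simp add: k_def)
  finally show "distribution_lift s \<le> distribution_lift t" .
qed

lemma lifted_interval_measurable [measurable]: "lifted_interval s t \<in> sets borel"
  unfolding lifted_interval_def by measurable

text \<open>As \<Phi> is increasing and commutes with integer translations, a point lies in the arc
  from 0 to \<open>t\<close> iff its image lies in the arc from \<open>\<Phi> 0\<close> to
  \<open>\<Phi> t\<close>. Invariance gives both arcs the same mass, hence equal increments.\<close>

lemma distribution_lift_Phi: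
  "distribution_lift (\<Phi> t) = distribution_lift t + (distribution_lift (\<Phi> 0) - distribution_lift 0)"
proof -
  have *: "distribution_lift (\<Phi> t) - distribution_lift (\<Phi> 0) = distribution_lift t - distribution_lift 0"
    if "0 \<le> t" "t < 1" for t
  proof -
    have Phi: "\<Phi> 0 \<le> \<Phi> t" "\<Phi> t \<le> \<Phi> 0 + 1"
      using that strict_mono_less_eq[OF Phi_strict_mono, of 0 t]
        strict_mono_less_eq[OF Phi_strict_mono, of t "0 + 1"] Phi_add_1[of 0] by auto
    have "frac (\<Phi> x) \<in> lifted_interval (\<Phi> 0) (\<Phi> t) \<longleftrightarrow> frac x \<in> lifted_interval 0 t" for x
      unfolding frac_in_lifted_interval Phi_add_int[symmetric]
      by (simp only: strict_mono_less[OF Phi_strict_mono] strict_mono_less_eq[OF Phi_strict_mono])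
    then have "frac (\<Phi> x) \<in> lifted_interval (\<Phi> 0) (\<Phi> t) \<longleftrightarrow> x \<in> lifted_interval 0 t"
      if "x \<in> {0..<1}" for x
      using that frac_id[of x] by (metis atLeastLessThan_iff)
    then have "AE x in \<nu>. frac (\<Phi> x) \<in> lifted_interval (\<Phi> 0) (\<Phi> t) \<longleftrightarrow> x \<in> lifted_interval 0 t"
      by (rule eventually_mono[OF concentrated])
    then have "measure \<nu> {x \<in> space \<nu>. frac (\<Phi> x) \<in> lifted_interval (\<Phi> 0) (\<Phi> t)} =
        measure \<nu> (lifted_interval 0 t)"
      by (intro measure_eq_AE) auto
    moreover have "measure \<nu> (lifted_interval (\<Phi> 0) (\<Phi> t)) =
        measure (distr \<nu> borel (\<lambda>x. frac (\<Phi> x))) (lifted_interval (\<Phi> 0) (\<Phi> t))"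
      by (simp add: invariant)
    moreover have "\<dots> = measure \<nu> {x \<in> space \<nu>. frac (\<Phi> x) \<in> lifted_interval (\<Phi> 0) (\<Phi> t)}"
      by (subst measure_distr) (auto simp: vimage_def intro!: arg_cong[where f = "measure \<nu>"])
    ultimately show ?thesis
      using measure_lifted_interval[OF Phi] measure_lifted_interval[of 0 t] that by simp
  qed
  have "distribution_lift (\<Phi> (frac t)) - distribution_lift (\<Phi> 0) =
      distribution_lift (frac t) - distribution_lift 0"
    by (rule *) (simp_all add: frac_lt_1)
  moreover have "\<Phi> t = \<Phi> (frac t) + of_int \<lfloor>t\<rfloor>" "t = frac t + of_int \<lfloor>t\<rfloor>"
    using Phi_add_int[of "frac t" "\<lfloor>t\<rfloor>"] by (simp_all add: frac_def)
  ultimately show ?thesis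
    using distribution_lift_add_int[of "\<Phi> (frac t)" "\<lfloor>t\<rfloor>"]
      distribution_lift_add_int[of "frac t" "\<lfloor>t\<rfloor>"] by simp
qed

text \<open>Uniqueness gives equality up to a constant; what remains is that 0 carries no mass. On
  [0,1) the increment \<open>\<Gamma> t - \<Gamma> 0\<close> is at most
  \<open>1 - cdf \<nu> 0\<close>, and as \<open>t\<close> tends to 1 it tends to 1, by continuity of
  \<Gamma>.\<close>

lemma distribution_lift_eq: "distribution_lift t = \<Gamma> t - \<Gamma> 0"
proof -
  have eq: "distribution_lift t = \<Gamma> t + (distribution_lift 0 - \<Gamma> 0)" for t
    using distribution_lift_mono distribution_lift_add_1 distribution_lift_Phi
    by (rule semiconjugacy_unique)
  have "\<Gamma> t - \<Gamma> 0 \<le> 1 - cdf \<nu> 0" if "0 \<le> t" "t < 1" for t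
    using eq[of t] that cdf_bounded_prob[of t] by (simp add: distribution_lift_unit)
  moreover have "(\<Gamma> \<longlongrightarrow> \<Gamma> 1) (at_left 1)"
    using Gamma_continuous by (simp add: continuous_on_eq_continuous_at isCont_def filterlim_at_split)
  then have "((\<lambda>t. \<Gamma> t - \<Gamma> 0) \<longlongrightarrow> \<Gamma> 1 - \<Gamma> 0) (at_left 1)"
    by (intro tendsto_intros)
  ultimately have "\<Gamma> 1 - \<Gamma> 0 \<le> 1 - cdf \<nu> 0"
    by (elim tendsto_upperbound)
      (auto intro!: eventually_mono[OF eventually_at_left_real[of 0 1]])
  then have "cdf \<nu> 0 \<le> 0" using Gamma_add_1[of 0] by simp
  then have "distribution_lift 0 = 0"
    using cdf_nonneg[of 0] distribution_lift_unit[of 0] by simp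
  then show ?thesis using eq[of t] by simp
qed

lemma cdf_unit: "0 \<le> x \<Longrightarrow> x < 1 \<Longrightarrow> cdf \<nu> x = \<Gamma> x - \<Gamma> 0"
  using distribution_lift_eq[of x] by (simp add: distribution_lift_unit)

end

section \<open>Lebesgue measure transported by a right inverse\<close>

locale invariant_circle_measure_section =
  invariant_circle_measure \<Phi> \<Gamma> \<rho> \<nu> + circle_semiconjugacy_section \<Phi> \<Gamma> \<rho> \<Theta>
  for \<Phi> \<Gamma> \<rho> \<nu> \<Theta>
begin

lemma measure_preimage_le:
  assumes x: "0 \<le> x" "x < 1"
  shows "measure lborel {t \<in> {0..<1}. frac (\<Theta> t) \<le> x} = \<Gamma> x - \<Gamma> 0"
proof -
  define B where "B = {t. frac (\<Theta> t) \<le> x}"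
  have [measurable]: "B \<in> sets borel" unfolding B_def by measurable
  have "{t \<in> {0..<1}. frac (\<Theta> t) \<le> x} = B \<inter> {0..<1}" by (auto simp: B_def)
  \<comment> \<open>In the window starting at \<open>\<Gamma> 0\<close>, inner points
    \<open>t\<close> have \<open>\<Theta> t\<close> in (0,1), where \<open>frac\<close> is the
    identity. There \<open>B\<close> is the interval from \<open>\<Gamma> 0\<close> to
    \<open>\<Gamma> x\<close> up to its endpoints.\<close>
  moreover have "emeasure lborel (B \<inter> {0..<1}) = emeasure lborel (B \<inter> {\<Gamma> 0..<\<Gamma> 0 + 1})"
    by (rule emeasure_lborel_periodic[symmetric]) (auto simp: B_def Theta_add_1 frac_1_eq)
  moreover have "emeasure lborel (B \<inter> {\<Gamma> 0..<\<Gamma> 0 + 1}) = ennreal (\<Gamma> x - \<Gamma> 0)"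
  proof (rule antisym)
    have "\<Gamma> x \<le> \<Gamma> 0 + 1" using Gamma_le[of x "0 + 1"] x by (simp only: Gamma_add_1)
    have "\<Gamma> 0 \<le> \<Gamma> x" using x by (intro Gamma_le)
    have "t \<le> \<Gamma> x" if "t \<in> B" "\<Gamma> 0 \<le> t" "t < \<Gamma> 0 + 1" for t
    proof (rule ccontr)
      assume "\<not> t \<le> \<Gamma> x"
      then have "x < \<Theta> t" "\<Theta> t < 0 + 1"
        using less_Theta Theta_less[of t "0 + 1"] that
        by (auto simp only: Gamma_add_1 not_le)
      then show False using that x by (simp add: B_def frac_id)
    qed
    then have "emeasure lborel (B \<inter> {\<Gamma> 0..<\<Gamma> 0 + 1}) \<le> emeasure lborel {\<Gamma> 0..\<Gamma> x}"
      by (intro emeasure_mono) auto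
    then show "emeasure lborel (B \<inter> {\<Gamma> 0..<\<Gamma> 0 + 1}) \<le> ennreal (\<Gamma> x - \<Gamma> 0)"
      using \<open>\<Gamma> 0 \<le> \<Gamma> x\<close> by simp
    have "t \<in> B" if "\<Gamma> 0 < t" "t < \<Gamma> x" for t
      using less_Theta[OF that(1)] Theta_less[OF that(2)] x
      by (simp add: B_def frac_id)
    then have "emeasure lborel {\<Gamma> 0<..<\<Gamma> x} \<le> emeasure lborel (B \<inter> {\<Gamma> 0..<\<Gamma> 0 + 1})"
      using \<open>\<Gamma> x \<le> \<Gamma> 0 + 1\<close> by (intro emeasure_mono) auto
    then show "ennreal (\<Gamma> x - \<Gamma> 0) \<le> emeasure lborel (B \<inter> {\<Gamma> 0..<\<Gamma> 0 + 1})"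
      using \<open>\<Gamma> 0 \<le> \<Gamma> x\<close> by simp
  qed
  ultimately show ?thesis
    using Gamma_le[OF x(1)] by (simp add: measure_def)
qed

text \<open>Both measures have distribution function \<open>\<Gamma> x - \<Gamma> 0\<close> on [0,1)
  and give no mass to the complement.\<close>

lemma distr_frac_Theta: "distr (restrict_space lborel {0..<1}) borel (\<lambda>t. frac (\<Theta> t)) = \<nu>"
proof (rule cdf_unique)
  let ?N = "distr (restrict_space lborel {0..<1}) borel (\<lambda>t. frac (\<Theta> t))"
  have [measurable]: "(\<lambda>t. frac (\<Theta> t)) \<in> borel_measurable (restrict_space lborel {0..<1})"
    by (intro measurable_restrict_space1) simp
  interpret U: prob_space "restrict_space lborel {0..<1::real}"
    by (rule prob_spaceI) (simp add: emeasure_restrict_space)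
  show "real_distribution \<nu>" ..
  show N: "real_distribution ?N"
    by (intro real_distribution.intro U.prob_space_distr real_distribution_axioms.intro) simp_all
  have cdf_N: "cdf ?N x = measure lborel {t \<in> {0..<1}. frac (\<Theta> t) \<le> x}" for x
    unfolding cdf_def
    by (subst measure_distr) (auto simp: measure_restrict_space space_restrict_space vimage_def
        intro!: arg_cong[where f = "measure lborel"])
  show "cdf ?N = cdf \<nu>"
  proof
    fix x :: real
    consider "x < 0" | "0 \<le> x" "x < 1" | "x \<ge> 1" by linarith
    then show "cdf ?N x = cdf \<nu> x"
    proof cases
      case 1
      then have "{t \<in> {0..<1}. frac (\<Theta> t) \<le> x} = {}"
        using frac_ge_0 by (force simp: not_le intro: less_le_trans)
      then have "cdf ?N x = 0" unfolding cdf_N by (simp only: measure_empty)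
      then show ?thesis using 1 by (simp add: measure_neg cdf_def2)
    next
      case 2
      then show ?thesis by (simp only: cdf_N measure_preimage_le cdf_unit)
    next
      case 3
      then have "{t \<in> {0..<1}. frac (\<Theta> t) \<le> x} = {0..<1}"
        using frac_lt_1 by (force intro: less_imp_le less_le_trans)
      moreover have "measure \<nu> {..<1} \<le> measure \<nu> {..x}"
        using 3 by (intro finite_measure_mono) auto
      then have "cdf \<nu> x = 1"
        using measure_unit prob_le_1[of "{..x}"] unfolding cdf_def2 by linarith
      ultimately show ?thesis by (simp add: cdf_N)
    qed
  qed
qed

text \<open>A periodic \<open>p\<close> does not see the fractional part in
  \<open>distr_frac_Theta\<close>.\<close>

lemma emeasure_distr_periodic:
  assumes p: "p \<in> borel_measurable borel" "\<And>t. p (t + 1) = (p t :: real)" and A: "A \<in> sets borel"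
  shows "emeasure (distr \<nu> borel p) A = emeasure lborel {t \<in> {0..<1}. p (\<Theta> t) \<in> A}"
proof -
  note [measurable] = p(1) A
  have [measurable]: "(\<lambda>t. frac (\<Theta> t)) \<in> borel_measurable (restrict_space lborel {0..<1})"
    by (intro measurable_restrict_space1) simp
  have "distr \<nu> borel p = distr (restrict_space lborel {0..<1}) borel (\<lambda>t. p (frac (\<Theta> t)))"
    by (subst distr_frac_Theta[symmetric]) (simp add: distr_distr o_def)
  also have "\<dots> = distr (restrict_space lborel {0..<1}) borel (\<lambda>t. p (\<Theta> t))"
    by (simp add: periodic_frac[of p, OF p(2)])
  finally have eq: "distr \<nu> borel p = distr (restrict_space lborel {0..<1}) borel (\<lambda>t. p (\<Theta> t))" .
  show ?thesis
    by (subst eq, subst emeasure_distr)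
      (auto simp: emeasure_restrict_space space_restrict_space vimage_def
        intro!: arg_cong[where f = "emeasure lborel"] measurable_restrict_space1)
qed

lemma emeasure_displacement:
  assumes A: "A \<in> sets borel"
  shows "emeasure (distr \<nu> borel (\<lambda>t. \<Phi> t - t)) A =
    emeasure (lebesgue_on {0..1}) {t \<in> {0..1}. \<Theta> (t + \<rho>) - \<Theta> t \<in> A}"
proof -
  note [measurable] = A
  have "AE t in lborel. isCont \<Theta> (t + \<rho>)"
    by (rule AE_isCont_Theta)
  \<comment> \<open>The two sets differ at most in the endpoint 1 and in those \<open>t\<close> for
    which \<open>t + \<rho>\<close> is a discontinuity of \<Theta>.\<close>
  then have "AE t in lborel. t \<in> {t \<in> {0..<1}. \<Phi> (\<Theta> t) - \<Theta> t \<in> A} \<longleftrightarrow>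
      t \<in> {t \<in> {0..1}. \<Theta> (t + \<rho>) - \<Theta> t \<in> A}"
    using AE_lborel_singleton[of 1]
    by eventually_elim (auto simp: Phi_Theta)
  then have "emeasure lborel {t \<in> {0..<1}. \<Phi> (\<Theta> t) - \<Theta> t \<in> A} =
      emeasure lborel {t \<in> {0..1}. \<Theta> (t + \<rho>) - \<Theta> t \<in> A}"
    by (rule emeasure_eq_AE) measurable
  also have "\<dots> = emeasure (lebesgue_on {0..1}) {t \<in> {0..1}. \<Theta> (t + \<rho>) - \<Theta> t \<in> A}"
    by (subst emeasure_restrict_space) auto
  finally show ?thesis
    by (subst emeasure_distr_periodic) (auto simp: Phi_add_1)
qed

text \<open>The image of the growth set is compact, and its complement is null because
  \<open>\<Theta> t\<close> is a growth point for almost every \<open>t\<close>. Conversely, near a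
  growth point \<open>t\<close> the values between \<open>\<Gamma> (t - e)\<close> and
  \<open>\<Gamma> (t + e)\<close> form an interval of positive length that \<Theta> sends into (t -
  e, t + e).\<close>

lemma measure_support_displacement_section:
  "measure_support (distr \<nu> borel (\<lambda>t. \<Phi> t - t)) = (\<lambda>t. \<Phi> t - t) ` growth_set"
proof -
  define \<Psi> where "\<Psi> t = \<Phi> t - t" for t
  have Psi_cont: "continuous_on UNIV \<Psi>"
    unfolding \<Psi>_def by (intro continuous_intros Phi_continuous)
  then have [measurable]: "\<Psi> \<in> borel_measurable borel"
    by (rule borel_measurable_continuous_onI)
  have Psi_per: "\<Psi> (t + 1) = \<Psi> t" for t by (simp add: \<Psi>_def Phi_add_1)
  have Psi_distr: "emeasure (distr \<nu> borel \<Psi>) A = emeasure lborel {t \<in> {0..<1}. \<Psi> (\<Theta> t) \<in> A}"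
    if "A \<in> sets borel" for A
    by (rule emeasure_distr_periodic) (use that Psi_per in auto)
  have "compact (\<Psi> ` growth_set)"
    by (subst periodic_image[of \<Psi>, OF Psi_per growth_set_add_1])
      (intro compact_continuous_image continuous_on_subset[OF Psi_cont] closed_Int_compact
        closed_growth_set; simp)
  then have op: "open (- \<Psi> ` growth_set)" by (simp add: compact_imp_closed open_Compl)
  have "AE t in lborel. t \<notin> {t \<in> {0..<1}. \<Psi> (\<Theta> t) \<in> - \<Psi> ` growth_set}"
    using AE_isCont_Theta[of 0, simplified]
    by eventually_elim (auto dest: Theta_in_growth_set)
  from emeasure_eq_0_AE[OF this]
  have "emeasure lborel {t \<in> {0..<1}. \<Psi> (\<Theta> t) \<in> - \<Psi> ` growth_set} = 0" by simp
  then have null: "emeasure (distr \<nu> borel \<Psi>) (- \<Psi> ` growth_set) = 0"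
    using Psi_distr[OF borel_open[OF op]] by simp
  have "emeasure (distr \<nu> borel \<Psi>) U > 0" if U: "open U" "\<Psi> t \<in> U" and t: "t \<in> growth_set" for U t
  proof -
    have [measurable]: "U \<in> sets borel" using U(1) by simp
    define B where "B = {s. \<Psi> (\<Theta> s) \<in> U}"
    have [measurable]: "B \<in> sets borel" unfolding B_def by measurable
    have "open (\<Psi> -` U)" using open_vimage[OF U(1) Psi_cont] .
    then obtain e where e: "e > 0" "ball t e \<subseteq> \<Psi> -` U"
      using U(2) by (meson open_contains_ball vimage_eq)
    \<comment> \<open>The minimum keeps the interval inside one window of length 1, so that
      periodicity applies.\<close>
    let ?a = "\<Gamma> (t - e)" and ?b = "min (\<Gamma> (t + e)) (\<Gamma> (t - e) + 1)"
    have "s \<in> B" if "?a < s" "s < ?b" for s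
    proof -
      have "t - e < \<Theta> s" "\<Theta> s < t + e"
        using less_Theta[OF that(1)] Theta_less[of s "t + e"] that(2) by auto
      then show ?thesis using e(2) by (auto simp: B_def dist_real_def subset_iff abs_less_iff)
    qed
    then have "emeasure lborel {?a<..<?b} \<le> emeasure lborel (B \<inter> {?a..<?a + 1})"
      by (intro emeasure_mono) auto
    also have "\<dots> = emeasure lborel (B \<inter> {0..<1})"
      by (rule emeasure_lborel_periodic) (auto simp: B_def Theta_add_1 Psi_per)
    also have "\<dots> = emeasure (distr \<nu> borel \<Psi>) U"
      by (subst Psi_distr) (auto simp: B_def intro!: arg_cong[where f = "emeasure lborel"])
    finally have "emeasure lborel {?a<..<?b} \<le> emeasure (distr \<nu> borel \<Psi>) U" .
    moreover have "?a < ?b" using growth_setD[OF t, of "t - e" "t + e"] e(1) by simp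
    then have "emeasure lborel {?a<..<?b} > 0" by simp
    ultimately show ?thesis by (rule less_le_trans[rotated])
  qed
  then have "measure_support (distr \<nu> borel \<Psi>) = \<Psi> ` growth_set"
    using op null by (auto simp: measure_support_def)
  then show ?thesis by (simp add: \<Psi>_def [abs_def])
qed

end

text \<open>The support does not depend on \<Theta>, so any right inverse may serve as an
  auxiliary.\<close>

lemma (in invariant_circle_measure) measure_support_displacement:
  "measure_support (distr \<nu> borel (\<lambda>t. \<Phi> t - t)) = (\<lambda>t. \<Phi> t - t) ` growth_set"
proof -
  obtain \<Theta> where "\<And>t. \<Gamma> (\<Theta> t) = t" "\<And>t. \<Theta> (t + 1) = \<Theta> t + 1"
    using section_exists by auto
  then interpret invariant_circle_measure_section \<Phi> \<Gamma> \<rho> \<nu> \<Theta>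
    by unfold_locales
  show ?thesis by (rule measure_support_displacement_section)
qed

section \<open>Lifts of circle maps\<close>

lemma circle_proj_add_int [simp]: "circle_proj (t + of_int k) = circle_proj t"
  by (simp add: circle_proj_def distrib_left cis_mult [symmetric] cis_multiple_2pi)

lemma circle_proj_add_1 [simp]: "circle_proj (t + 1) = circle_proj t"
  using circle_proj_add_int[of t 1] by simp

lemma circle_phase_unit: "0 \<le> circle_phase z" "circle_phase z < 1"
  by (simp_all add: circle_phase_def Arg2pi_ge_0 Arg2pi_lt_2pi)

lemma circle_phase_proj [simp]: "circle_phase (circle_proj t) = frac t"
proof -
  have "circle_proj t = circle_proj (frac t)"
    using circle_proj_add_int[of "frac t" "\<lfloor>t\<rfloor>"] by (simp add: frac_def)
  then have "Arg2pi (circle_proj t) = 2 * pi * frac t"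
    by (intro Arg2pi_unique[of 1]) (simp_all add: circle_proj_def cis_conv_exp frac_lt_1)
  then show ?thesis by (simp add: circle_phase_def)
qed

lemma circle_proj_eq_iff: "circle_proj s = circle_proj t \<longleftrightarrow> (\<exists>k::int. s = t + of_int k)"
proof
  assume "circle_proj s = circle_proj t"
  then have "frac s = frac t" by (metis circle_phase_proj)
  then show "\<exists>k::int. s = t + of_int k"
    by (intro exI[of _ "\<lfloor>s\<rfloor> - \<lfloor>t\<rfloor>"]) (simp add: frac_def)
qed auto

lemma circle_proj_in_sphere [simp]: "circle_proj t \<in> sphere 0 1"
  by (simp add: circle_proj_def)

lemma circle_proj_mult: "circle_proj s * circle_proj t = circle_proj (s + t)"
  by (simp add: circle_proj_def cis_mult distrib_left)

lemma continuous_on_circle_proj [continuous_intros]: "continuous_on S circle_proj"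
  unfolding circle_proj_def [abs_def] cis_conv_exp by (intro continuous_intros)

lemma circle_phase_measurable [measurable]: "circle_phase \<in> borel_measurable borel"
proof -
  have "continuous_on (- \<real>\<^sub>\<ge>\<^sub>0) Arg2pi"
    by (intro continuous_at_imp_continuous_on ballI continuous_at_Arg2pi) auto
  \<comment> \<open>The value 0 on the cut is the actual value of \<open>Arg2pi\<close> there,
    including at the origin.\<close>
  then have "(\<lambda>z. if z \<in> - \<real>\<^sub>\<ge>\<^sub>0 then Arg2pi z else 0) \<in> borel_measurable borel"
    by (intro borel_measurable_continuous_on_if) auto
  also have "(\<lambda>z. if z \<in> - \<real>\<^sub>\<ge>\<^sub>0 then Arg2pi z else 0) = Arg2pi"
    by (auto simp: fun_eq_iff Arg2pi_eq_0 complex_nonneg_Reals_iff complex_is_Real_iff)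
  finally show ?thesis
    unfolding circle_phase_def [abs_def] by measurable
qed

text \<open>The difference of two lifts is continuous and integer-valued, hence constant.\<close>

lemma lift_unique:
  assumes "lift_of G g" "lift_of H g"
  shows "\<exists>k::int. \<forall>t. G t = H t + of_int k"
proof -
  define d where "d t = G t - H t" for t
  have int: "d t \<in> \<int>" for t
  proof -
    have "circle_proj (G t) = circle_proj (H t)"
      using assms unfolding lift_of_def by metis
    then show ?thesis by (auto simp: circle_proj_eq_iff d_def)
  qed
  have "d constant_on UNIV"
  proof (rule continuous_discrete_range_constant)
    show "continuous_on UNIV d"
      unfolding d_def using assms by (auto simp: lift_of_def intro!: continuous_intros)
    show "\<exists>e>0. \<forall>y. y \<in> UNIV \<and> d y \<noteq> d x \<longrightarrow> e \<le> norm (d y - d x)" for x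
      using Ints_nonzero_abs_ge1[of "d _ - d x"] int
      by (intro exI[of _ 1]) (auto intro: Ints_diff)
  qed auto
  then obtain c where c: "d t = c" for t by (auto simp: constant_on_def)
  then obtain k :: int where "c = of_int k" using int[of 0] by (auto simp: Ints_def)
  then show ?thesis using c by (intro exI[of _ k]) (auto simp: d_def algebra_simps)
qed

text \<open>\<open>monotone_degree_one\<close> speaks of some lift only; the given one differs from
  it by an integer.\<close>

lemma lift_of_monotone_degree_one:
  assumes "monotone_degree_one g" "lift_of G g"
  shows "mono G" "G (t + 1) = G t + 1"
proof -
  obtain H where H: "lift_of H g" "mono H" "\<And>t. H (t + 1) = H t + 1"
    using assms(1) by (auto simp: monotone_degree_one_def)
  then obtain k :: int where "G t = H t + of_int k" for t
    using lift_unique[OF assms(2)] by blast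
  then show "mono G" "G (t + 1) = G t + 1"
    using H(2,3) by (auto simp: mono_def)
qed

text \<open>The identity on the circle lifts only up to an integer constant \<open>k\<close>; the
  rotation number of \<Phi> forces \<open>k = 0\<close>.\<close>

lemma semiconj_to_rotation_lift:
  assumes \<gamma>: "semiconj_to_rotation \<phi> \<rho> \<gamma>" "lift_of \<Gamma> \<gamma>"
    and \<Phi>: "continuous_on UNIV \<Phi>" "\<And>t. \<phi> (circle_proj t) = circle_proj (\<Phi> t)"
      "has_rotation_number \<Phi> \<rho>"
  shows "\<Gamma> (\<Phi> t) = \<Gamma> t + \<rho>"
proof -
  have lift: "continuous_on UNIV \<Gamma>" "\<gamma> (circle_proj t) = circle_proj (\<Gamma> t)" for t
    using \<gamma>(2) by (auto simp: lift_of_def)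
  have "lift_of (\<lambda>t. \<Gamma> (\<Phi> t)) (\<lambda>z. \<gamma> (\<phi> z))"
    using \<Phi>(1) lift unfolding lift_of_def
    by (auto simp: \<Phi>(2) intro: continuous_on_compose2)
  moreover have "\<gamma> (\<phi> (circle_proj t)) = circle_proj (\<Gamma> t + \<rho>)" for t
    using \<gamma>(1) circle_proj_in_sphere[of t]
    by (simp add: semiconj_to_rotation_def lift(2) circle_proj_mult add.commute del: mem_sphere)
  then have "lift_of (\<lambda>t. \<Gamma> t + \<rho>) (\<lambda>z. \<gamma> (\<phi> z))"
    using lift(1) by (auto simp: lift_of_def intro!: continuous_intros)
  ultimately obtain k :: int where k: "\<And>t. \<Gamma> (\<Phi> t) = \<Gamma> t + \<rho> + of_int k"
    using lift_unique by blast
  have "\<rho> + of_int k = \<rho>"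
    using \<gamma> k unfolding semiconj_to_rotation_def
    by (intro rotation_number_semiconj[OF \<Phi>(3), of \<Gamma>] lift_of_monotone_degree_one)
      (auto simp: add.assoc)
  then show ?thesis using k by simp
qed

lemma funpow_lift:
  assumes "\<And>t. \<phi> (circle_proj t) = circle_proj (\<Phi> t)"
  shows "(\<phi> ^^ n) (circle_proj t) = circle_proj ((\<Phi> ^^ n) t)"
  by (induction n) (simp_all add: assms)

lemma translate_into_unit_interval:
  fixes a t :: real
  obtains k :: int where "a < t + of_int k" "t + of_int k \<le> a + 1"
proof (rule that)
  show "a < t + of_int (\<lfloor>a - t\<rfloor> + 1)" "t + of_int (\<lfloor>a - t\<rfloor> + 1) \<le> a + 1"
    by linarith+
qed

text \<open>If the translated orbit missed (a, b), the orbit on the circle would stay in the closed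
  image of \<open>{b..a + 1}\<close>, and so would the whole circle, its closure. A point
  \<open>c\<close> just after \<open>a\<close> is not in that image.\<close>

lemma circle_transitive_lift_dense:
  assumes "circle_transitive \<phi>" and \<phi>: "\<And>t. \<phi> (circle_proj t) = circle_proj (\<Phi> t)"
  obtains x where "\<And>a b. a < b \<Longrightarrow> \<exists>n (k::int). (\<Phi> ^^ n) x + of_int k \<in> {a<..<b}"
proof -
  obtain z where z: "z \<in> sphere 0 1" "closure (range (\<lambda>n. (\<phi> ^^ n) z)) = sphere 0 1"
    using assms(1) by (auto simp: circle_transitive_def)
  define x where "x = circle_phase z"
  have orbit: "(\<phi> ^^ n) z = circle_proj ((\<Phi> ^^ n) x)" for n
    using funpow_lift[of \<phi> \<Phi> n x, OF \<phi>] z(1) by (simp add: x_def circle_proj_phase)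
  have "\<exists>n (k::int). (\<Phi> ^^ n) x + of_int k \<in> {a<..<b}" if "a < b" for a b
  proof (rule ccontr)
    assume none: "\<not> ?thesis"
    let ?F = "circle_proj ` {b..a + 1}"
    have "(\<phi> ^^ n) z \<in> ?F" for n
    proof -
      obtain k :: int where k: "a < (\<Phi> ^^ n) x + of_int k" "(\<Phi> ^^ n) x + of_int k \<le> a + 1"
        by (rule translate_into_unit_interval)
      then have "(\<Phi> ^^ n) x + of_int k \<in> {b..a + 1}" using none by force
      then show ?thesis by (force simp: orbit intro: image_eqI[where x = "(\<Phi> ^^ n) x + of_int k"])
    qed
    moreover have "closed ?F"
      by (intro compact_imp_closed compact_continuous_image continuous_intros) simp
    ultimately have "sphere 0 1 \<subseteq> ?F"
      using z(2) closure_minimal[of "range (\<lambda>n. (\<phi> ^^ n) z)" ?F] by blast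
    moreover obtain c where c: "a < c" "c < b" "c < a + 1"
      using dense[of a "min b (a + 1)"] \<open>a < b\<close> by auto
    ultimately have "circle_proj c \<in> ?F" using circle_proj_in_sphere by blast
    then obtain s k where "s \<in> {b..a + 1}" "c = s + of_int k"
      by (auto simp: circle_proj_eq_iff)
    then have "of_int k < (0::real)" "of_int k > (-1::real)" using c by auto
    then show False by simp
  qed
  then show ?thesis by (rule that)
qed

section \<open>Transitivity and minimal sets\<close>

context circle_semiconjugacy
begin

text \<open>On an interval where \<Gamma> is constant, two distinct translated orbit points have
  equal \<Gamma>-values. Equal times would make them the same point, and different times would make
  \<rho> rational.\<close>

lemma dense_orbit_imp_strict_mono:
  assumes dense: "\<And>a b. a < b \<Longrightarrow> \<exists>n (k::int). (\<Phi> ^^ n) x + of_int k \<in> {a<..<b}"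
  shows "strict_mono \<Gamma>"
proof (rule strict_monoI)
  fix a b :: real assume "a < b"
  have "\<Gamma> a \<noteq> \<Gamma> b"
  proof
    assume "\<Gamma> a = \<Gamma> b"
    then have const: "\<Gamma> s = \<Gamma> a" if "s \<in> {a<..<b}" for s
      using that Gamma_le[of a s] Gamma_le[of s b] by auto
    obtain n k where nk: "(\<Phi> ^^ n) x + of_int k \<in> {a<..<b}"
      using dense[OF \<open>a < b\<close>] by blast
    \<comment> \<open>Searching strictly to the right of the first point ensures that the second is
      distinct.\<close>
    then obtain m j where mj: "(\<Phi> ^^ m) x + of_int j \<in> {(\<Phi> ^^ n) x + of_int k<..<b}"
      using dense[of "(\<Phi> ^^ n) x + of_int k" b] by auto
    have "\<Gamma> ((\<Phi> ^^ n) x + of_int k) = \<Gamma> ((\<Phi> ^^ m) x + of_int j)"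
      using const nk mj by simp
    then have eq: "(real n - real m) * \<rho> = of_int (j - k)"
      unfolding Gamma_orbit by (simp add: algebra_simps)
    show False
    proof (cases "n = m")
      case True
      then show ?thesis using eq mj by simp
    next
      case False
      then have "\<rho> = of_int (j - k) / (of_int (int n - int m))"
        using eq by (simp add: field_simps)
      then show ?thesis using irrational by (metis Rats_divide Rats_of_int)
    qed
  qed
  then show "\<Gamma> a < \<Gamma> b" using Gamma_le[of a b] \<open>a < b\<close> by simp
qed

text \<open>An orbit inside the closed set \<Delta> accumulates on every growth point, so the
  projected growth set lies in \<Delta>. It is itself nonempty, closed and invariant, so minimality
  gives equality.\<close>

lemma circle_lift_set_minimal:
  assumes \<phi>: "\<And>t. \<phi> (circle_proj t) = circle_proj (\<Phi> t)" and minimal: "minimal_set \<phi> \<Delta>"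
  shows "circle_lift_set \<Delta> = growth_set"
proof -
  have D: "\<Delta> \<noteq> {}" "\<Delta> \<subseteq> sphere 0 1" "closed \<Delta>" "\<phi> ` \<Delta> \<subseteq> \<Delta>"
    using minimal by (auto simp: minimal_set_def circle_invariant_closed_def)
  obtain x where x: "circle_proj x \<in> \<Delta>"
    using D(1,2) circle_proj_phase by (metis all_not_in_conv subsetD)
  have orbit: "circle_proj ((\<Phi> ^^ n) x) \<in> \<Delta>" for n
    using x D(4) by (induction n) (auto simp flip: \<phi>)
  have growth_lift: "circle_proj t \<in> \<Delta>" if t: "t \<in> growth_set" for t
  proof -
    have "t \<in> closure (circle_lift_set \<Delta>)"
      unfolding closure_approachable
    proof (intro allI impI)
      fix e :: real assume "e > 0"
      then obtain n k where "(\<Phi> ^^ n) x + of_int k \<in> {t - e<..<t + e}"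
        using orbit_accumulates_on_growth_set[OF t, of "t - e" "t + e" x] by auto
      then show "\<exists>y\<in>circle_lift_set \<Delta>. dist y t < e"
        using orbit[of n]
        by (intro bexI[of _ "(\<Phi> ^^ n) x + of_int k"]) (auto simp: circle_lift_set_def dist_real_def)
    qed
    moreover have "closed (circle_lift_set \<Delta>)"
      using closed_vimage[OF D(3) continuous_on_circle_proj]
      by (simp add: circle_lift_set_def vimage_def)
    ultimately show ?thesis by (simp add: circle_lift_set_def)
  qed
  let ?E = "circle_proj ` growth_set"
  have "compact ?E"
    by (subst periodic_image[of circle_proj, OF circle_proj_add_1 growth_set_add_1])
      (intro compact_continuous_image continuous_intros closed_Int_compact closed_growth_set; simp)
  then have "circle_invariant_closed \<phi> ?E"
    using growth_set_nonempty growth_set_Phi circle_proj_in_sphere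
    by (auto simp: circle_invariant_closed_def compact_imp_closed \<phi> simp del: mem_sphere)
  moreover have "?E \<subseteq> \<Delta>" using growth_lift by blast
  ultimately have E: "?E = \<Delta>" using minimal by (simp add: minimal_set_def)
  have "t \<in> growth_set" if lift: "circle_proj t \<in> \<Delta>" for t
  proof -
    obtain s k where "s \<in> growth_set" "t = s + of_int k"
      using lift unfolding E[symmetric] by (auto simp: circle_proj_eq_iff)
    then show ?thesis
      using periodic_add_int[of "\<lambda>t. t \<in> growth_set", OF growth_set_add_1] by simp
  qed
  then show ?thesis using growth_lift by (auto simp: circle_lift_set_def)
qed

end

text \<open>On the circle, injectivity and surjectivity leave an integer undetermined; degree one
  makes it 0 for injectivity and absorbs it into the preimage for surjectivity.\<close>

lemma lift_bij_betw:
  assumes lift: "\<And>t. \<gamma> (circle_proj t) = circle_proj (\<Gamma> t)"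
    and deg: "\<And>t. \<Gamma> (t + 1) = \<Gamma> t + 1"
    and bij: "bij_betw \<gamma> D (sphere 0 1)" and D: "D \<subseteq> sphere 0 1"
  shows "bij_betw \<Gamma> (circle_lift_set D) UNIV"
proof (rule bij_betw_imageI)
  show "inj_on \<Gamma> (circle_lift_set D)"
  proof (rule inj_onI)
    fix s t assume st: "s \<in> circle_lift_set D" "t \<in> circle_lift_set D" "\<Gamma> s = \<Gamma> t"
    then have "circle_proj s = circle_proj t"
      using bij lift by (auto simp: circle_lift_set_def bij_betw_def inj_on_def)
    then obtain k :: int where "s = t + of_int k" by (auto simp: circle_proj_eq_iff)
    then show "s = t" using st(3) degree_one_add_int[of \<Gamma> t k, OF deg] by simp
  qed
  have "t \<in> \<Gamma> ` circle_lift_set D" for t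
  proof -
    obtain z where z: "z \<in> D" "\<gamma> z = circle_proj t"
      using bij circle_proj_in_sphere[of t] unfolding bij_betw_def by (metis imageE)
    define s where "s = circle_phase z"
    have s: "circle_proj s = z" unfolding s_def using z(1) D by (intro circle_proj_phase) auto
    then have "circle_proj t = circle_proj (\<Gamma> s)" using lift[of s] z(2) by simp
    then obtain k :: int where "t = \<Gamma> s + of_int k" by (auto simp: circle_proj_eq_iff)
    then have "t = \<Gamma> (s + of_int k)" by (simp add: degree_one_add_int[of \<Gamma>, OF deg])
    moreover have "s + of_int k \<in> circle_lift_set D" using s z(1) by (simp add: circle_lift_set_def)
    ultimately show ?thesis by blast
  qed
  then show "\<Gamma> ` circle_lift_set D = UNIV" by auto
qed

lemma inv_into_degree_one:
  fixes \<Gamma> :: "real \<Rightarrow> real"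
  assumes "bij_betw \<Gamma> S UNIV" "\<And>t. \<Gamma> (t + 1) = \<Gamma> t + 1" "\<And>t. t \<in> S \<Longrightarrow> t + 1 \<in> S"
  shows "\<Gamma> (inv_into S \<Gamma> t) = t" "inv_into S \<Gamma> (t + 1) = inv_into S \<Gamma> t + 1"
proof -
  show right: "\<Gamma> (inv_into S \<Gamma> t) = t" for t
    using assms(1) by (intro bij_betw_inv_into_right) auto
  show "inv_into S \<Gamma> (t + 1) = inv_into S \<Gamma> t + 1"
    using assms right[of t] inv_into_into[of t \<Gamma> S]
    by (intro inv_into_f_eq) (auto simp: bij_betw_def)
qed

section \<open>Distribution and support of the interspike-intervals\<close>

theorem proposition3p12:
  fixes \<sigma> \<rho> :: real and f :: "real \<Rightarrow> real"
    and \<gamma> :: "complex \<Rightarrow> complex" and \<Gamma> :: "real \<Rightarrow> real" and \<mu> :: "complex measure"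
  assumes "\<sigma> \<ge> 0"
    and "locally_integrable f"
    and "AE t in lebesgue. f (t + 1) = f t"
    and "AE t in lebesgue. f t - \<sigma> > 0"
    and "has_rotation_number (firing_map \<sigma> f) \<rho>" and "\<rho> \<notin> \<rat>"
    and "semiconj_to_rotation (firing_phase_map \<sigma> f) \<rho> \<gamma>"
    and "lift_of \<Gamma> \<gamma>"
    and "invariant_prob (firing_phase_map \<sigma> f) \<mu>"
  shows
    "(circle_transitive (firing_phase_map \<sigma> f) \<longrightarrow>
       (let \<Omega> = (\<lambda>t. inv \<Gamma> (t + \<rho>) - inv \<Gamma> t) in
         (\<forall>A\<in>sets borel. emeasure (isi_distribution \<sigma> f \<mu>) A =
            emeasure (lebesgue_on {0..1}) {t\<in>{0..1}. \<Omega> t \<in> A}) \<and>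
         measure_support (isi_distribution \<sigma> f \<mu>) = firing_displacement \<sigma> f ` {0..1} \<and>
         firing_displacement \<sigma> f ` {0..1} = \<Omega> ` {0..1}))
     \<and>
     (\<not> circle_transitive (firing_phase_map \<sigma> f) \<longrightarrow>
       (\<forall>\<Delta>. minimal_set (firing_phase_map \<sigma> f) \<Delta> \<longrightarrow>
         (\<forall>\<Delta>'. \<Delta>' \<subseteq> \<Delta> \<and> bij_betw \<gamma> \<Delta>' (sphere 0 1) \<longrightarrow>
           (let \<Gamma>inv = inv_into (circle_lift_set \<Delta>') \<Gamma>;
                \<Omega> = (\<lambda>t. \<Gamma>inv (t + \<rho>) - \<Gamma>inv t) in
             \<forall>A\<in>sets borel. A \<subseteq> firing_displacement \<sigma> f ` circle_lift_set \<Delta> \<longrightarrow>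
               emeasure (isi_distribution \<sigma> f \<mu>) A =
               emeasure (lebesgue_on {0..1}) {t\<in>{0..1}. \<Omega> t \<in> A})) \<and>
         measure_support (isi_distribution \<sigma> f \<mu>) =
           firing_displacement \<sigma> f ` circle_lift_set \<Delta>))"
proof -
  interpret integrate_and_fire \<sigma> f using assms(1-4) by unfold_locales
  let ?\<Phi> = "firing_map \<sigma> f" and ?\<phi> = "firing_phase_map \<sigma> f" and ?\<Psi> = "firing_displacement \<sigma> f"
  \<comment> \<open>The measure \<mu> in the phase coordinate, viewed on the whole line so that
    distribution functions are available.\<close>
  define \<nu> where "\<nu> = distr \<mu> borel circle_phase"
  have phi_proj: "?\<phi> (circle_proj t) = circle_proj (?\<Phi> t)" for t
    using degree_one_add_int[of ?\<Phi> "frac t" "\<lfloor>t\<rfloor>", OF firing_map_add_1]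
    by (simp add: firing_phase_map_def frac_def)
  have lift: "continuous_on UNIV \<Gamma>" "\<And>t. \<gamma> (circle_proj t) = circle_proj (\<Gamma> t)"
    using assms(8) by (auto simp: lift_of_def)
  have degree: "monotone_degree_one \<gamma>" using assms(7) by (simp add: semiconj_to_rotation_def)
  have semiconj: "circle_semiconjugacy ?\<Phi> \<Gamma> \<rho>"
    using firing_map_continuous firing_map_strict_mono firing_map_add_1 lift(1)
      lift_of_monotone_degree_one[OF degree assms(8)] assms(5,6)
      semiconj_to_rotation_lift[OF assms(7,8) firing_map_continuous phi_proj assms(5)]
    by unfold_locales
  then interpret circle_semiconjugacy ?\<Phi> \<Gamma> \<rho> .

  have mu: "sets \<mu> = sets (restrict_space borel (sphere 0 1))" "prob_space \<mu>"
      "?\<phi> \<in> measurable \<mu> \<mu>" "distr \<mu> \<mu> ?\<phi> = \<mu>"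
    using assms(9) by (auto simp: invariant_prob_def)
  note [measurable] = mu(3)
  have phase [measurable]: "circle_phase \<in> borel_measurable \<mu>"
    unfolding measurable_cong_sets[OF mu(1) refl]
    by (intro measurable_restrict_space1) measurable
  have Phi_meas [measurable]: "?\<Phi> \<in> borel_measurable borel"
    using firing_map_continuous by (rule borel_measurable_continuous_onI)
  have "real_distribution \<nu>"
    unfolding \<nu>_def using mu(2) phase
    by (intro real_distribution.intro prob_space.prob_space_distr real_distribution_axioms.intro) auto
  moreover have "AE x in \<nu>. x \<in> {0..<1}"
    unfolding \<nu>_def by (subst AE_distr_iff) (auto simp: circle_phase_unit)
  moreover have "distr \<nu> borel (\<lambda>x. frac (?\<Phi> x)) = \<nu>"
  proof -
    have "distr \<nu> borel (\<lambda>x. frac (?\<Phi> x)) = distr \<mu> borel (\<lambda>z. circle_phase (?\<phi> z))"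
      unfolding \<nu>_def by (simp add: distr_distr o_def firing_phase_map_def)
    also have "\<dots> = distr (distr \<mu> \<mu> ?\<phi>) borel circle_phase"
      by (simp add: distr_distr o_def)
    finally show ?thesis by (simp add: mu(4) \<nu>_def)
  qed
  ultimately have inv_measure: "invariant_circle_measure ?\<Phi> \<Gamma> \<rho> \<nu>"
    using semiconj by (intro invariant_circle_measure.intro invariant_circle_measure_axioms.intro)
  then interpret invariant_circle_measure ?\<Phi> \<Gamma> \<rho> \<nu> .

  have Psi: "?\<Psi> = (\<lambda>t. ?\<Phi> t - t)" by (simp add: fun_eq_iff firing_displacement_def)
  have isi: "isi_distribution \<sigma> f \<mu> = distr \<nu> borel (\<lambda>t. ?\<Phi> t - t)"
  proof -
    have "circle_phase \<in> measurable \<mu> (restrict_space borel {0..1})"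
      using phase circle_phase_unit by (intro measurable_restrict_space2) (auto simp: less_imp_le)
    moreover have "(\<lambda>t. ?\<Phi> t - t) \<in> borel_measurable (restrict_space borel {0..1})"
      by (intro measurable_restrict_space1) measurable
    ultimately show ?thesis
      by (simp add: isi_distribution_def on_unit_interval_def Psi \<nu>_def distr_distr)
  qed
  have Psi_per: "?\<Psi> (t + 1) = ?\<Psi> t" for t
    by (simp add: Psi firing_map_add_1)
  \<comment> \<open>Serves both cases: \<open>S\<close> is \<open>UNIV\<close> in the transitive
    case and the lift of \<open>\<Delta>'\<close> otherwise.\<close>
  have section_formula: "emeasure (isi_distribution \<sigma> f \<mu>) A =
      emeasure (lebesgue_on {0..1}) {t \<in> {0..1}. inv_into S \<Gamma> (t + \<rho>) - inv_into S \<Gamma> t \<in> A}"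
    if "bij_betw \<Gamma> S UNIV" "\<And>t. t \<in> S \<Longrightarrow> t + 1 \<in> S" "A \<in> sets borel" for S A
  proof -
    interpret invariant_circle_measure_section ?\<Phi> \<Gamma> \<rho> \<nu> "inv_into S \<Gamma>"
      using inv_into_degree_one[OF that(1) Gamma_add_1 that(2)] by unfold_locales
    show ?thesis using emeasure_displacement[OF that(3)] by (simp add: isi)
  qed
  have support: "measure_support (isi_distribution \<sigma> f \<mu>) = ?\<Psi> ` growth_set"
    using measure_support_displacement by (simp add: isi Psi)

  show ?thesis
    unfolding Let_def
  proof (intro conjI impI allI ballI)
    assume "circle_transitive ?\<phi>"
    then have strict: "strict_mono \<Gamma>"
      using circle_transitive_lift_dense[where \<phi> = ?\<phi> and \<Phi> = ?\<Phi>] phi_proj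
        dense_orbit_imp_strict_mono by metis
    then have "growth_set = UNIV"
      by (auto simp: growth_set_def strict_mono_less)
    moreover have unit: "?\<Psi> ` UNIV = ?\<Psi> ` {0..1}"
      using periodic_image[of ?\<Psi> UNIV, OF Psi_per] by simp
    ultimately show "measure_support (isi_distribution \<sigma> f \<mu>) = ?\<Psi> ` {0..1}"
      using support by simp
    \<comment> \<open>A map with a right inverse is surjective.\<close>
    have "surj \<Gamma>" using section_exists by (metis surjI)
    with strict have bij: "bij \<Gamma>" by (simp add: bij_def strict_mono_imp_inj_on)
    then show "emeasure (isi_distribution \<sigma> f \<mu>) A =
        emeasure (lebesgue_on {0..1}) {t \<in> {0..1}. inv \<Gamma> (t + \<rho>) - inv \<Gamma> t \<in> A}"
      if "A \<in> sets borel" for A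
      using section_formula[of UNIV] that by simp
    let ?\<Omega> = "\<lambda>t. inv \<Gamma> (t + \<rho>) - inv \<Gamma> t"
    have inv: "\<Gamma> (inv \<Gamma> t) = t" "inv \<Gamma> (t + 1) = inv \<Gamma> t + 1" for t
      using inv_into_degree_one[OF bij Gamma_add_1] by auto
    \<comment> \<open>With \<Gamma> injective this holds for every \<open>t\<close>, not just almost
      everywhere, so the images are equal as sets.\<close>
    have "inv \<Gamma> (t + \<rho>) = ?\<Phi> (inv \<Gamma> t)" for t
      using bij by (intro inv_f_eq) (simp_all add: bij_is_inj Gamma_Phi inv(1))
    then have "?\<Omega> = (\<lambda>t. ?\<Psi> (inv \<Gamma> t))"
      by (simp add: fun_eq_iff Psi)
    then have "?\<Omega> ` UNIV = ?\<Psi> ` UNIV"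
      using bij_is_surj[OF bij_imp_bij_inv[OF bij]] by (metis image_image)
    moreover have "?\<Omega> (t + 1) = ?\<Omega> t" for t
      using inv(2)[of "t + \<rho>"] inv(2)[of t] by (simp add: algebra_simps)
    then have "?\<Omega> ` UNIV = ?\<Omega> ` {0..1}"
      using periodic_image[of ?\<Omega> UNIV] by simp
    ultimately show "?\<Psi> ` {0..1} = ?\<Omega> ` {0..1}" using unit by simp
  next
    fix \<Delta> assume minimal: "minimal_set ?\<phi> \<Delta>"
    then show "measure_support (isi_distribution \<sigma> f \<mu>) = ?\<Psi> ` circle_lift_set \<Delta>"
      using support circle_lift_set_minimal[where \<phi> = ?\<phi>, OF phi_proj] by simp
    fix \<Delta>' and A :: "real set"
    assume D: "\<Delta>' \<subseteq> \<Delta> \<and> bij_betw \<gamma> \<Delta>' (sphere 0 1)" and A: "A \<in> sets borel"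
    have "\<Delta>' \<subseteq> sphere 0 1"
      using D minimal by (auto simp: minimal_set_def circle_invariant_closed_def)
    then have "bij_betw \<Gamma> (circle_lift_set \<Delta>') UNIV"
      using D by (intro lift_bij_betw[OF lift(2) Gamma_add_1]) auto
    then show "emeasure (isi_distribution \<sigma> f \<mu>) A = emeasure (lebesgue_on {0..1})
        {t \<in> {0..1}. inv_into (circle_lift_set \<Delta>') \<Gamma> (t + \<rho>) -
          inv_into (circle_lift_set \<Delta>') \<Gamma> t \<in> A}"
      using A by (intro section_formula) (auto simp: circle_lift_set_def)
  qed
qed

end
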